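(* Let $p \ge 1$ be an integer. Suppose we are given a dataset of $n$ points $X = \{x_1, \ldots, x_n\} \subset \mathbb{R}^d$, which implicitly defines the $n \times n$ matrix $A$ with $A_{i,j} = \|x_i - x_j\|_p^p$. Given a query $z \in \mathbb{R}^n$, there is an algorithm (with access to $X$, but which does not form $A$ explicitly) that computes $Az$ exactly in time $O(ndp)$. If $p$ is odd, the algorithm additionally requires $O(nd \log n)$ preprocessing time.
   Context: $\|v\|_p^p = \sum_{i=1}^d |v_i|^p$ for $v \in \mathbb{R}^d$. Preprocessing is performed once on the dataset $X$, independently of the query $z$, and can be reused for all queries. *)

theory Defs
  imports "Jordan_Normal_Form.Matrix"
begin

section \<open>The matrix of \<open>p\<close>-th powers of \<open>\<ell>\<^sub>p\<close> distances\<close>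

definition pnorm_pow :: "nat \<Rightarrow> real vec \<Rightarrow> real" where
  "pnorm_pow p v = (\<Sum>i<dim_vec v. \<bar>v $ i\<bar> ^ p)"

definition dist_mat :: "nat \<Rightarrow> nat \<Rightarrow> (nat \<Rightarrow> real vec) \<Rightarrow> real mat" where
  "dist_mat p n x = mat n n (\<lambda>(i, j). pnorm_pow p (x i - x j))"

section \<open>A real RAM\<close>

text \<open>
  Running times refer to a real RAM with unit costs, presented as a structured language.
  A program uses finitely many registers and arrays, of natural numbers (for counters and
  indices) or of reals. The model is kept weak, so that unit costs are not abused:
  natural numbers can only be added, subtracted and compared; there is no rounding or other
  flow of data from reals to naturals except through comparisons; the only constants are integers.
\<close>

type_synonym name = string

datatype nexp =
    NConst nat
  | NReg name
  | NGet name nexp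
  | NAdd nexp nexp
  | NSub nexp nexp

datatype rexp =
    RConst int
  | RReg name
  | RGet name nexp
  | RAdd rexp rexp
  | RSub rexp rexp
  | RMul rexp rexp
  | RDiv rexp rexp

datatype bexp =
    NLess nexp nexp
  | RLess rexp rexp
  | Not bexp
  | And bexp bexp

datatype com =
    Skip
  | NAssign name nexp
  | RAssign name rexp
  | NPut name nexp nexp
  | RPut name nexp rexp
  | Seq com com
  | If bexp com com
  | While bexp com

record state =
  nreg :: "name \<Rightarrow> nat"
  rreg :: "name \<Rightarrow> real"
  narr :: "name \<Rightarrow> nat \<Rightarrow> nat"
  rarr :: "name \<Rightarrow> nat \<Rightarrow> real"

text \<open>Subtraction of naturals is truncated, and division by zero yields zero.\<close>

primrec nval :: "nexp \<Rightarrow> state \<Rightarrow> nat" where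
  "nval (NConst k) s = k"
| "nval (NReg a) s = nreg s a"
| "nval (NGet a e) s = narr s a (nval e s)"
| "nval (NAdd e f) s = nval e s + nval f s"
| "nval (NSub e f) s = nval e s - nval f s"

primrec rval :: "rexp \<Rightarrow> state \<Rightarrow> real" where
  "rval (RConst k) s = of_int k"
| "rval (RReg a) s = rreg s a"
| "rval (RGet a e) s = rarr s a (nval e s)"
| "rval (RAdd e f) s = rval e s + rval f s"
| "rval (RSub e f) s = rval e s - rval f s"
| "rval (RMul e f) s = rval e s * rval f s"
| "rval (RDiv e f) s = rval e s / rval f s"

primrec bval :: "bexp \<Rightarrow> state \<Rightarrow> bool" where
  "bval (NLess e f) s \<longleftrightarrow> nval e s < nval f s"
| "bval (RLess e f) s \<longleftrightarrow> rval e s < rval f s"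
| "bval (Not b) s \<longleftrightarrow> \<not> bval b s"
| "bval (And b c) s \<longleftrightarrow> bval b s \<and> bval c s"

text \<open>Evaluating an expression costs one unit per node; there is no short-circuit evaluation.\<close>

primrec ncost :: "nexp \<Rightarrow> nat" where
  "ncost (NConst k) = 1"
| "ncost (NReg a) = 1"
| "ncost (NGet a e) = ncost e + 1"
| "ncost (NAdd e f) = ncost e + ncost f + 1"
| "ncost (NSub e f) = ncost e + ncost f + 1"

primrec rcost :: "rexp \<Rightarrow> nat" where
  "rcost (RConst k) = 1"
| "rcost (RReg a) = 1"
| "rcost (RGet a e) = ncost e + 1"
| "rcost (RAdd e f) = rcost e + rcost f + 1"
| "rcost (RSub e f) = rcost e + rcost f + 1"
| "rcost (RMul e f) = rcost e + rcost f + 1"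
| "rcost (RDiv e f) = rcost e + rcost f + 1"

primrec bcost :: "bexp \<Rightarrow> nat" where
  "bcost (NLess e f) = ncost e + ncost f + 1"
| "bcost (RLess e f) = rcost e + rcost f + 1"
| "bcost (Not b) = bcost b + 1"
| "bcost (And b c) = bcost b + bcost c + 1"

text \<open>\<open>exec c s t s'\<close>: started in \<open>s\<close>, the program \<open>c\<close> halts in \<open>s'\<close> after \<open>t\<close> time units.\<close>

inductive exec :: "com \<Rightarrow> state \<Rightarrow> nat \<Rightarrow> state \<Rightarrow> bool" where
  Skip: "exec Skip s 1 s"
| NAssign: "exec (NAssign a e) s (ncost e + 1) (s\<lparr>nreg := (nreg s)(a := nval e s)\<rparr>)"
| RAssign: "exec (RAssign a e) s (rcost e + 1) (s\<lparr>rreg := (rreg s)(a := rval e s)\<rparr>)"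
| NPut: "exec (NPut a i e) s (ncost i + ncost e + 1)
    (s\<lparr>narr := (narr s)(a := (narr s a)(nval i s := nval e s))\<rparr>)"
| RPut: "exec (RPut a i e) s (ncost i + rcost e + 1)
    (s\<lparr>rarr := (rarr s)(a := (rarr s a)(nval i s := rval e s))\<rparr>)"
| Seq: "exec c s t s' \<Longrightarrow> exec d s' u s'' \<Longrightarrow> exec (Seq c d) s (t + u) s''"
| IfTrue: "bval b s \<Longrightarrow> exec c s t s' \<Longrightarrow> exec (If b c d) s (bcost b + t + 1) s'"
| IfFalse: "\<not> bval b s \<Longrightarrow> exec d s t s' \<Longrightarrow> exec (If b c d) s (bcost b + t + 1) s'"
| WhileFalse: "\<not> bval b s \<Longrightarrow> exec (While b c) s (bcost b + 1) s"
| WhileTrue: "bval b s \<Longrightarrow> exec c s t s' \<Longrightarrow> exec (While b c) s' u s'' \<Longrightarrow>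
    exec (While b c) s (bcost b + t + u + 1) s''"

inductive_cases exec_elims:
  "exec Skip s t s'" "exec (NAssign a e) s t s'" "exec (RAssign a e) s t s'"
  "exec (NPut a i e) s t s'" "exec (RPut a i e) s t s'" "exec (Seq c d) s t s'"
  "exec (If b c d) s t s'" "exec (While b c) s t s'"

lemma exec_deterministic:
  assumes "exec c s t s'" and "exec c s u s''"
  shows "u = t \<and> s'' = s'"
  using assms
proof (induction arbitrary: u s'' rule: exec.induct)
  case (Seq c s t s' d v s2)
  from Seq.prems obtain t1 s1 t2 where
    "u = t1 + t2" "exec c s t1 s1" "exec d s1 t2 s''"
    by (auto elim: exec_elims(6))
  with Seq.IH show ?case by blast
next
  case (IfTrue b s c t s' d)
  from IfTrue.prems IfTrue.hyps(1) obtain t1 where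
    "u = bcost b + t1 + 1" "exec c s t1 s''"
    by (auto elim: exec_elims(7))
  with IfTrue.IH show ?case by blast
next
  case (IfFalse b s d t s' c)
  from IfFalse.prems IfFalse.hyps(1) obtain t1 where
    "u = bcost b + t1 + 1" "exec d s t1 s''"
    by (auto elim: exec_elims(7))
  with IfFalse.IH show ?case by blast
next
  case (WhileFalse b s c)
  from WhileFalse.prems show ?case
    by (rule exec_elims(8)) (use WhileFalse.hyps in auto)
next
  case (WhileTrue b s c t s' v s2)
  from WhileTrue.prems obtain t1 s1 t2 where
    "u = bcost b + t1 + t2 + 1" "exec c s t1 s1" "exec (While b c) s1 t2 s''"
    by (rule exec_elims(8)) (use WhileTrue.hyps(1) in auto)
  with WhileTrue.IH show ?case by blast
qed (auto elim: exec_elims(1-5))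

text \<open>
  A run of \<open>t\<close> time units modifies at most \<open>t\<close> cells of the real arrays. Hence an algorithm whose total
  running time is below \<open>n\<^sup>2\<close> cannot write down an \<open>n \<times> n\<close> matrix.
\<close>

lemma rarr_changes_trans:
  fixes r r' r'' :: "name \<Rightarrow> nat \<Rightarrow> real"
  assumes "finite {(a, i). r' a i \<noteq> r a i} \<and> card {(a, i). r' a i \<noteq> r a i} \<le> t"
    and "finite {(a, i). r'' a i \<noteq> r' a i} \<and> card {(a, i). r'' a i \<noteq> r' a i} \<le> u"
  shows "finite {(a, i). r'' a i \<noteq> r a i} \<and> card {(a, i). r'' a i \<noteq> r a i} \<le> t + u"
proof -
  let ?S = "{(a, i). r' a i \<noteq> r a i}" and ?T = "{(a, i). r'' a i \<noteq> r' a i}"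
  have sub: "{(a, i). r'' a i \<noteq> r a i} \<subseteq> ?S \<union> ?T" by auto
  have fin: "finite (?S \<union> ?T)" using assms by blast
  have "card {(a, i). r'' a i \<noteq> r a i} \<le> card (?S \<union> ?T)" by (rule card_mono[OF fin sub])
  also have "\<dots> \<le> card ?S + card ?T" by (rule card_Un_le)
  also have "\<dots> \<le> t + u" using assms by (intro add_mono) blast+
  finally show ?thesis using finite_subset[OF sub fin] by blast
qed

lemma exec_rarr_changes:
  assumes "exec c s t s'"
  shows "finite {(a, i). rarr s' a i \<noteq> rarr s a i} \<and> card {(a, i). rarr s' a i \<noteq> rarr s a i} \<le> t"
  using assms
proof (induction rule: exec.induct)
  case (RPut a i e s)
  let ?s' = "s\<lparr>rarr := (rarr s)(a := (rarr s a)(nval i s := rval e s))\<rparr>"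
  have sub: "{(b, j). rarr ?s' b j \<noteq> rarr s b j} \<subseteq> {(a, nval i s)}"
    by (auto split: if_splits)
  have "card {(b, j). rarr ?s' b j \<noteq> rarr s b j} \<le> card {(a, nval i s)}"
    by (rule card_mono[OF _ sub]) simp
  with finite_subset[OF sub] show ?case by simp
next
  case (Seq c s t s' d u s'')
  from rarr_changes_trans[OF Seq.IH] show ?case .
next
  case (WhileTrue b s c t s' u s'')
  from rarr_changes_trans[OF WhileTrue.IH] show ?case by linarith
next
  case (IfTrue b s c t s' d)
  then show ?case by linarith
next
  case (IfFalse b s d t s' c)
  then show ?case by linarith
qed simp_all

section \<open>Input, queries and results\<close>

text \<open>
  The input consists of \<open>n\<close>, \<open>d\<close>, \<open>p\<close> and the \<open>n\<close> points in row-major order; all the other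
  memory is zero.
\<close>

definition input :: "nat \<Rightarrow> nat \<Rightarrow> nat \<Rightarrow> (nat \<Rightarrow> real vec) \<Rightarrow> state" where
  "input n d p x = \<lparr>
     nreg = (\<lambda>_. 0)(''n'' := n, ''d'' := d, ''p'' := p),
     rreg = (\<lambda>_. 0),
     narr = (\<lambda>_ _. 0),
     rarr = (\<lambda>_ _. 0)(''X'' := \<lambda>k. if k < n * d then x (k div d) $ (k mod d) else 0)\<rparr>"

definition pose_query :: "real vec \<Rightarrow> state \<Rightarrow> state" where
  "pose_query z s = s\<lparr>rarr := (rarr s)(''z'' := \<lambda>i. if i < dim_vec z then z $ i else 0)\<rparr>"

definition result :: "nat \<Rightarrow> state \<Rightarrow> real vec" where
  "result n s = vec n (rarr s ''y'')"

text \<open>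
  \<open>answers Q A B s zs\<close>: starting from memory \<open>s\<close>, the program \<open>Q\<close> answers the queries \<open>zs\<close> one after
  the other by their products with \<open>A\<close>, each in time at most \<open>B\<close>. Memory is not reset between
  queries, so \<open>Q\<close> has to preserve whatever later queries rely on.
\<close>

primrec answers :: "com \<Rightarrow> real mat \<Rightarrow> real \<Rightarrow> state \<Rightarrow> real vec list \<Rightarrow> bool" where
  "answers Q A B s [] \<longleftrightarrow> True"
| "answers Q A B s (z # zs) \<longleftrightarrow>
    (\<exists>t s'. exec Q (pose_query z s) t s' \<and> real t \<le> B \<and>
       result (dim_row A) s' = A *\<^sub>v z \<and> answers Q A B s' zs)"

end

theory Submission
  imports Defs
begin

text \<open>
  Fix a coordinate \<open>k\<close> and write \<open>f i\<close> for the \<open>k\<close>-th entry of \<open>x i\<close>. For even \<open>p\<close> the absolute value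
  in \<open>\<Sum>j. z j * \<bar>f i - f j\<bar> ^ p\<close> disappears, and by the binomial theorem the sum is a polynomial
  in \<open>f i\<close> whose coefficients are signed binomials times the moments \<open>\<Sum>j. z j * f j ^ l\<close>,
  \<open>l \<le> p\<close>. For odd \<open>p\<close> the term of \<open>j\<close> carries the sign of \<open>f i - f j\<close>; visiting the points in
  increasing order of \<open>f\<close>, each visit flips one sign in the signed moments, from \<open>-1\<close> to \<open>1\<close>.
  The order comes from a bottom-up merge sort of each coordinate. Both parities share one query
  program: the initial sign \<open>\<sigma>\<close> and the increment \<open>\<tau>\<close> are \<open>1, 0\<close> for even and \<open>-1, 2\<close> for odd \<open>p\<close>.
\<close>

section \<open>Total correctness with time bounds\<close>

notation Seq (infixr ";;" 60)

text \<open>Since \<open>exec\<close> is deterministic, asking for one halting run of at most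
  \<open>T\<close> units amounts to total correctness with a time bound.\<close>

definition runs :: "com \<Rightarrow> state \<Rightarrow> nat \<Rightarrow> (state \<Rightarrow> bool) \<Rightarrow> bool" where
  "runs c s T Q \<longleftrightarrow> (\<exists>t s'. exec c s t s' \<and> t \<le> T \<and> Q s')"

lemma exec_atomic_iff:
  "exec Skip s t s' \<longleftrightarrow> t = 1 \<and> s' = s"
  "exec (NAssign a e) s t s' \<longleftrightarrow> t = ncost e + 1 \<and> s' = s\<lparr>nreg := (nreg s)(a := nval e s)\<rparr>"
  "exec (RAssign a r) s t s' \<longleftrightarrow> t = rcost r + 1 \<and> s' = s\<lparr>rreg := (rreg s)(a := rval r s)\<rparr>"
  "exec (NPut a i e) s t s' \<longleftrightarrow> t = ncost i + ncost e + 1 \<and>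
    s' = s\<lparr>narr := (narr s)(a := (narr s a)(nval i s := nval e s))\<rparr>"
  "exec (RPut a i r) s t s' \<longleftrightarrow> t = ncost i + rcost r + 1 \<and>
    s' = s\<lparr>rarr := (rarr s)(a := (rarr s a)(nval i s := rval r s))\<rparr>"
  by (rule iffI, (erule exec_elims(1-5), simp add: One_nat_def), (elim conjE, hypsubst, rule exec.intros))+

lemma runs_atomic [simp]:
  "runs Skip s T Q \<longleftrightarrow> 1 \<le> T \<and> Q s"
  "runs (NAssign a e) s T Q \<longleftrightarrow> ncost e + 1 \<le> T \<and> Q (s\<lparr>nreg := (nreg s)(a := nval e s)\<rparr>)"
  "runs (RAssign a r) s T Q \<longleftrightarrow> rcost r + 1 \<le> T \<and> Q (s\<lparr>rreg := (rreg s)(a := rval r s)\<rparr>)"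
  "runs (NPut a i e) s T Q \<longleftrightarrow> ncost i + ncost e + 1 \<le> T \<and>
    Q (s\<lparr>narr := (narr s)(a := (narr s a)(nval i s := nval e s))\<rparr>)"
  "runs (RPut a i r) s T Q \<longleftrightarrow> ncost i + rcost r + 1 \<le> T \<and>
    Q (s\<lparr>rarr := (rarr s)(a := (rarr s a)(nval i s := rval r s))\<rparr>)"
  unfolding runs_def exec_atomic_iff by auto

lemma runs_Seq_iff:
  "runs (c ;; d) s T Q \<longleftrightarrow>
    (\<exists>t s'. exec c s t s' \<and> t \<le> T \<and> runs d s' (T - t) Q)"
proof
  assume "runs (c ;; d) s T Q"
  then obtain t u s' s'' where "exec c s t s'" "exec d s' u s''" "t + u \<le> T" "Q s''"
    unfolding runs_def by (auto elim: exec_elims(6))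
  then show "\<exists>t s'. exec c s t s' \<and> t \<le> T \<and> runs d s' (T - t) Q"
    unfolding runs_def by (intro exI[of _ t] exI[of _ s'] conjI exI[of _ u] exI[of _ s'']) auto
next
  assume "\<exists>t s'. exec c s t s' \<and> t \<le> T \<and> runs d s' (T - t) Q"
  then obtain t u s' s'' where e: "exec c s t s'" "exec d s' u s''" and "t \<le> T" "u \<le> T - t" "Q s''"
    unfolding runs_def by auto
  then have "t + u \<le> T" by simp
  with exec.Seq[OF e] \<open>Q s''\<close> show "runs (c ;; d) s T Q" unfolding runs_def by blast
qed

lemma runs_If [simp]:
  "runs (If b c d) s T Q \<longleftrightarrow>
    bcost b + 1 \<le> T \<and> runs (if bval b s then c else d) s (T - (bcost b + 1)) Q"
proof
  assume "runs (If b c d) s T Q"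
  then obtain t s' where e: "exec (If b c d) s t s'" and "t \<le> T" "Q s'" unfolding runs_def by blast
  moreover from e obtain u where "t = bcost b + u + 1" "exec (if bval b s then c else d) s u s'"
    by (auto elim: exec_elims(7))
  ultimately show "bcost b + 1 \<le> T \<and> runs (if bval b s then c else d) s (T - (bcost b + 1)) Q"
    unfolding runs_def by (intro conjI exI[of _ u] exI[of _ s']) auto
next
  assume "bcost b + 1 \<le> T \<and> runs (if bval b s then c else d) s (T - (bcost b + 1)) Q"
  then obtain t s' where e: "exec (if bval b s then c else d) s t s'"
    and "t + bcost b + 1 \<le> T" "Q s'"
    unfolding runs_def by auto
  moreover have "exec (If b c d) s (bcost b + t + 1) s'"
    using e exec.IfTrue[of b s c t s' d] exec.IfFalse[of b s d t s' c] by (cases "bval b s") auto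
  ultimately show "runs (If b c d) s T Q"
    unfolding runs_def by (intro exI[of _ "bcost b + t + 1"] exI[of _ s']) auto
qed

text \<open>With these rules simplification executes straight-line code symbolically, charging each
  command to the budget. The conjunct that bounds the cost by \<open>T\<close> keeps the truncated
  subtraction exact.\<close>

lemma runs_Seq_atomic [simp]:
  "runs (Skip ;; c) s T Q \<longleftrightarrow> 1 \<le> T \<and> runs c s (T - 1) Q"
  "runs (NAssign a e ;; c) s T Q \<longleftrightarrow> ncost e + 1 \<le> T \<and>
    runs c (s\<lparr>nreg := (nreg s)(a := nval e s)\<rparr>) (T - (ncost e + 1)) Q"
  "runs (RAssign a r ;; c) s T Q \<longleftrightarrow> rcost r + 1 \<le> T \<and>
    runs c (s\<lparr>rreg := (rreg s)(a := rval r s)\<rparr>) (T - (rcost r + 1)) Q"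
  "runs (NPut a i e ;; c) s T Q \<longleftrightarrow> ncost i + ncost e + 1 \<le> T \<and>
    runs c (s\<lparr>narr := (narr s)(a := (narr s a)(nval i s := nval e s))\<rparr>) (T - (ncost i + ncost e + 1)) Q"
  "runs (RPut a i r ;; c) s T Q \<longleftrightarrow> ncost i + rcost r + 1 \<le> T \<and>
    runs c (s\<lparr>rarr := (rarr s)(a := (rarr s a)(nval i s := rval r s))\<rparr>) (T - (ncost i + rcost r + 1)) Q"
  unfolding runs_Seq_iff exec_atomic_iff by auto

text \<open>Oriented so that the leading command of a nested sequence comes to the front, where the
  symbolic execution rules apply.\<close>

lemma runs_Seq_assoc [simp]: "runs ((c ;; c') ;; d) s T Q \<longleftrightarrow> runs (c ;; c' ;; d) s T Q"
proof
  assume "runs ((c ;; c') ;; d) s T Q"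
  then obtain t1 t2 t3 s1 s2 s3 where
    e: "exec c s t1 s1" "exec c' s1 t2 s2" "exec d s2 t3 s3" and "t1 + t2 + t3 \<le> T" "Q s3"
    unfolding runs_def by (auto elim!: exec_elims(6))
  with exec.Seq[OF e(1) exec.Seq[OF e(2,3)]] show "runs (c ;; c' ;; d) s T Q"
    unfolding runs_def by (metis add.assoc)
next
  assume "runs (c ;; c' ;; d) s T Q"
  then obtain t1 t2 t3 s1 s2 s3 where
    e: "exec c s t1 s1" "exec c' s1 t2 s2" "exec d s2 t3 s3" and "t1 + (t2 + t3) \<le> T" "Q s3"
    unfolding runs_def by (auto elim!: exec_elims(6))
  with exec.Seq[OF exec.Seq[OF e(1,2)] e(3)] show "runs ((c ;; c') ;; d) s T Q"
    unfolding runs_def by (metis add.assoc)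
qed

section \<open>Syntactic frame conditions\<close>

primrec nregs_of :: "com \<Rightarrow> name set" where
  "nregs_of Skip = {}"
| "nregs_of (NAssign a e) = {a}"
| "nregs_of (RAssign a e) = {}"
| "nregs_of (NPut a i e) = {}"
| "nregs_of (RPut a i e) = {}"
| "nregs_of (Seq c d) = nregs_of c \<union> nregs_of d"
| "nregs_of (If b c d) = nregs_of c \<union> nregs_of d"
| "nregs_of (While b c) = nregs_of c"

primrec rregs_of :: "com \<Rightarrow> name set" where
  "rregs_of Skip = {}"
| "rregs_of (NAssign a e) = {}"
| "rregs_of (RAssign a e) = {a}"
| "rregs_of (NPut a i e) = {}"
| "rregs_of (RPut a i e) = {}"
| "rregs_of (Seq c d) = rregs_of c \<union> rregs_of d"
| "rregs_of (If b c d) = rregs_of c \<union> rregs_of d"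
| "rregs_of (While b c) = rregs_of c"

primrec narrs_of :: "com \<Rightarrow> name set" where
  "narrs_of Skip = {}"
| "narrs_of (NAssign a e) = {}"
| "narrs_of (RAssign a e) = {}"
| "narrs_of (NPut a i e) = {a}"
| "narrs_of (RPut a i e) = {}"
| "narrs_of (Seq c d) = narrs_of c \<union> narrs_of d"
| "narrs_of (If b c d) = narrs_of c \<union> narrs_of d"
| "narrs_of (While b c) = narrs_of c"

primrec rarrs_of :: "com \<Rightarrow> name set" where
  "rarrs_of Skip = {}"
| "rarrs_of (NAssign a e) = {}"
| "rarrs_of (RAssign a e) = {}"
| "rarrs_of (NPut a i e) = {}"
| "rarrs_of (RPut a i e) = {a}"
| "rarrs_of (Seq c d) = rarrs_of c \<union> rarrs_of d"
| "rarrs_of (If b c d) = rarrs_of c \<union> rarrs_of d"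
| "rarrs_of (While b c) = rarrs_of c"

definition frame :: "com \<Rightarrow> state \<Rightarrow> state \<Rightarrow> bool" where
  "frame c s s' \<longleftrightarrow>
     (\<forall>a. a \<notin> nregs_of c \<longrightarrow> nreg s' a = nreg s a) \<and>
     (\<forall>a. a \<notin> rregs_of c \<longrightarrow> rreg s' a = rreg s a) \<and>
     (\<forall>a. a \<notin> narrs_of c \<longrightarrow> narr s' a = narr s a) \<and>
     (\<forall>a. a \<notin> rarrs_of c \<longrightarrow> rarr s' a = rarr s a)"

lemma frameD:
  assumes "frame c s s'"
  shows "a \<notin> nregs_of c \<Longrightarrow> nreg s' a = nreg s a"
    and "a \<notin> rregs_of c \<Longrightarrow> rreg s' a = rreg s a"
    and "a \<notin> narrs_of c \<Longrightarrow> narr s' a = narr s a"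
    and "a \<notin> rarrs_of c \<Longrightarrow> rarr s' a = rarr s a"
  using assms unfolding frame_def by blast+

lemma exec_frame: "exec c s t s' \<Longrightarrow> frame c s s'"
  by (induction rule: exec.induct) (auto simp: frame_def)

lemma frame_trans: "frame c s s' \<Longrightarrow> frame c s' s'' \<Longrightarrow> frame c s s''"
  by (auto simp: frame_def)

text \<open>The frame is supplied together with the postcondition, here and in
  \<open>runs_Seq\<close>, so the specifications of program fragments can concentrate on what
  changes.\<close>

lemma runs_conseq:
  assumes "runs c s T Q" and "T \<le> T'" and "\<And>s'. frame c s s' \<Longrightarrow> Q s' \<Longrightarrow> Q' s'"
  shows "runs c s T' Q'"
  using assms exec_frame unfolding runs_def by (meson order_trans)

lemma runs_Seq:
  assumes "runs c s T Q" and "\<And>s'. frame c s s' \<Longrightarrow> Q s' \<Longrightarrow> runs d s' U R" and "T + U \<le> V"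
  shows "runs (c ;; d) s V R"
proof -
  obtain t s' where 1: "exec c s t s'" "t \<le> T" "Q s'" using assms(1) unfolding runs_def by blast
  obtain u s'' where 2: "exec d s' u s''" "u \<le> U" "R s''"
    using assms(2)[OF exec_frame[OF 1(1)] 1(3)] unfolding runs_def by blast
  have "t + u \<le> V" using 1 2 assms(3) by simp
  with exec.Seq[OF 1(1) 2(1)] 2(3) show ?thesis unfolding runs_def by blast
qed

lemma runs_While_True:
  assumes "bval b s" and "runs (c ;; While b c) s T Q" and "bcost b + T + 1 \<le> U"
  shows "runs (While b c) s U Q"
proof -
  obtain t u s' s'' where "exec c s t s'" "exec (While b c) s' u s''" "t + u \<le> T" "Q s''"
    using assms(2) unfolding runs_def by (auto elim: exec_elims(6))
  moreover from this have "bcost b + t + u + 1 \<le> U" using assms(3) by simp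
  ultimately show ?thesis
    using exec.WhileTrue[OF assms(1)] unfolding runs_def by blast
qed

lemma runs_While_False:
  assumes "\<not> bval b s" and "Q s" and "bcost b + 1 \<le> T"
  shows "runs (While b c) s T Q"
  using assms exec.WhileFalse unfolding runs_def by blast

section \<open>Counted loops\<close>

definition For :: "name \<Rightarrow> name \<Rightarrow> com \<Rightarrow> com" where
  "For i b c = NAssign i (NConst 0) ;;
     While (NLess (NReg i) (NReg b)) (c ;; NAssign i (NAdd (NReg i) (NConst 1)))"

lemma modifies_For [simp]:
  "nregs_of (For i b c) = insert i (nregs_of c)"
  "rregs_of (For i b c) = rregs_of c"
  "narrs_of (For i b c) = narrs_of c"
  "rarrs_of (For i b c) = rarrs_of c"
  by (auto simp: For_def)

text \<open>Besides the body a round costs 8 units, 4 for the test and 4 for the increment. The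
  initial assignment and the last test add 6, which \<open>1 \<le> N\<close> allows to be charged to
  the rounds; hence 14.\<close>

lemma runs_For:
  assumes N: "nreg s b = N" "1 \<le> N"
    and names: "i \<noteq> b" "i \<notin> nregs_of c" "b \<notin> nregs_of c"
    and init: "I 0 (s\<lparr>nreg := (nreg s)(i := 0)\<rparr>)"
    and step: "\<And>k s'. k < N \<Longrightarrow> frame (For i b c) s s' \<Longrightarrow> nreg s' i = k \<Longrightarrow> I k s' \<Longrightarrow>
      runs c s' T (\<lambda>s''. I (Suc k) (s''\<lparr>nreg := (nreg s'')(i := Suc k)\<rparr>))"
    and fin: "\<And>s'. frame (For i b c) s s' \<Longrightarrow> I N s' \<Longrightarrow> Q s'"
    and U: "N * (T + 14) \<le> U"
  shows "runs (For i b c) s U Q"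
proof -
  let ?b = "NLess (NReg i) (NReg b)" and ?c = "c ;; NAssign i (NAdd (NReg i) (NConst 1))"
  \<comment> \<open>Induction on the number \<open>r\<close> of rounds left; the counter then holds
    \<open>N - r\<close>.\<close>
  have loop: "runs (While ?b ?c) s' (r * (T + 8) + 4) Q"
    if "frame (For i b c) s s'" "nreg s' i = N - r" "r \<le> N" "I (N - r) s'" for r s'
    using that
  proof (induction r arbitrary: s')
    case 0
    then have "nreg s' b = N" using N names by (simp add: frameD)
    with 0 fin show ?case by (intro runs_While_False) auto
  next
    case (Suc r)
    let ?k = "N - Suc r"
    have b: "nreg s' b = N" using Suc.prems(1) N names by (simp add: frameD)
    have k: "Suc ?k = N - r" "?k < N" using Suc.prems by auto
    show ?case
    proof (rule runs_While_True)
      show "bval ?b s'" using b k Suc.prems by simp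
      show "runs (?c ;; While ?b ?c) s' (T + (4 + (r * (T + 8) + 4))) Q"
        unfolding runs_Seq_assoc
      proof (rule runs_Seq[OF step[OF k(2) Suc.prems(1,2,4)] _ order_refl])
        fix s'' assume fr: "frame c s' s''"
          and I: "I (Suc ?k) (s''\<lparr>nreg := (nreg s'')(i := Suc ?k)\<rparr>)"
        have i: "nreg s'' i = ?k" using fr names Suc.prems by (simp add: frameD)
        let ?s = "s''\<lparr>nreg := (nreg s'')(i := Suc ?k)\<rparr>"
        have "frame (For i b c) s' ?s" using fr by (auto simp: frame_def)
        then have "frame (For i b c) s ?s" using Suc.prems(1) by (rule frame_trans[rotated])
        then have "runs (While ?b ?c) ?s (r * (T + 8) + 4) Q"
          using I k Suc.prems(3) by (intro Suc.IH) auto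
        then show "runs (NAssign i (NAdd (NReg i) (NConst 1)) ;; While ?b ?c) s''
            (4 + (r * (T + 8) + 4)) Q"
          by (simp add: i add.commute[of 4])
      qed
      show "bcost ?b + (T + (4 + (r * (T + 8) + 4))) + 1 \<le> Suc r * (T + 8) + 4" by simp
    qed
  qed
  have "frame (For i b c) s (s\<lparr>nreg := (nreg s)(i := 0)\<rparr>)" by (auto simp: frame_def)
  then have "runs (While ?b ?c) (s\<lparr>nreg := (nreg s)(i := 0)\<rparr>) (N * (T + 8) + 4) Q"
    using init by (intro loop) auto
  then have "runs (For i b c) s (2 + (N * (T + 8) + 4)) Q"
    by (simp add: For_def add.commute[of 4])
  moreover have "2 + (N * (T + 8) + 4) \<le> U" using N(2) U by (auto simp: algebra_simps)
  ultimately show ?thesis by (rule runs_conseq)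
qed

section \<open>Signed moments and polynomial evaluation\<close>

text \<open>Naturals cannot be multiplied, so the offsets \<open>i * d\<close> are built by repeated
  addition and looked up afterwards.\<close>

definition rows :: com where
  "rows = NAssign ''q'' (NConst 0) ;;
     For ''i'' ''n'' (NPut ''row'' (NReg ''i'') (NReg ''q'') ;;
       NAssign ''q'' (NAdd (NReg ''q'') (NReg ''d'')))"

lemma modifies_rows [simp]:
  "nregs_of rows = {''q'', ''i''}" "rregs_of rows = {}" "narrs_of rows = {''row''}" "rarrs_of rows = {}"
  by (auto simp: rows_def)

lemma runs_rows:
  assumes "nreg s ''n'' = n" "1 \<le> n"
  shows "runs rows s (30 * n) (\<lambda>s'. \<forall>i<n. narr s' ''row'' i = i * nreg s ''d'')"
proof -
  let ?I = "\<lambda>k s'. nreg s' ''q'' = k * nreg s ''d'' \<and> (\<forall>i<k. narr s' ''row'' i = i * nreg s ''d'')"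
  show ?thesis unfolding rows_def
    apply simp
    apply (intro conjI)
    using assms apply simp
    apply (rule runs_For[where I = ?I and T = 7 and N = n])
    using assms apply (auto simp: frameD less_Suc_eq)
    done
qed

text \<open>The weight register doubles as the running power, so that one point updates all
  \<open>m\<close> moments in time linear in \<open>m\<close>.\<close>

definition add_powers :: com where
  "add_powers = For ''l'' ''m''
     (RPut ''S'' (NReg ''l'') (RAdd (RGet ''S'' (NReg ''l'')) (RReg ''w'')) ;;
      RAssign ''w'' (RMul (RReg ''w'') (RReg ''a'')))"

lemma modifies_add_powers [simp]:
  "nregs_of add_powers = {''l''}" "rregs_of add_powers = {''w''}"
  "narrs_of add_powers = {}" "rarrs_of add_powers = {''S''}"
  by (auto simp: add_powers_def)

lemma runs_add_powers:
  assumes "nreg s ''m'' = m" "1 \<le> m"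
  shows "runs add_powers s (30 * m)
    (\<lambda>s'. \<forall>l<m. rarr s' ''S'' l = rarr s ''S'' l + rreg s ''w'' * rreg s ''a'' ^ l)"
proof -
  \<comment> \<open>All entries of \<open>S\<close> are described, also those not yet reached,
    because a later round adds to the old value.\<close>
  let ?I = "\<lambda>k s'. rreg s' ''w'' = rreg s ''w'' * rreg s ''a'' ^ k \<and> (\<forall>l. rarr s' ''S'' l =
    rarr s ''S'' l + (if l < k then rreg s ''w'' * rreg s ''a'' ^ l else 0))"
  show ?thesis unfolding add_powers_def
    apply (rule runs_For[where I = ?I and T = 12 and N = m])
    using assms apply (auto simp: frameD less_Suc_eq)
    done
qed

definition horner :: com where
  "horner = RAssign ''v'' (RConst 0) ;; For ''l'' ''m''
     (RAssign ''v'' (RAdd (RMul (RReg ''v'') (RReg ''a''))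
        (RMul (RGet ''c'' (NReg ''l'')) (RGet ''S'' (NReg ''l'')))))"

lemma modifies_horner [simp]:
  "nregs_of horner = {''l''}" "rregs_of horner = {''v''}" "narrs_of horner = {}" "rarrs_of horner = {}"
  by (auto simp: horner_def)

text \<open>Horner's rule: multiplication by \<open>a\<close> raises every exponent, and the new
  coefficient enters with exponent 0. The highest power comes first, as the moment of order
  \<open>l\<close> is paired with \<open>a ^ (p - l)\<close>.\<close>

lemma horner_step:
  fixes a :: real
  shows "(\<Sum>l<Suc k. g l * a ^ (k - l)) = (\<Sum>l<k. g l * a ^ (k - Suc l)) * a + g k"
proof -
  have "g l * a ^ (k - l) = g l * a ^ (k - Suc l) * a" if "l < k" for l
    using that by (simp add: power_Suc2 flip: Suc_diff_Suc)
  then have "(\<Sum>l<k. g l * a ^ (k - l)) = (\<Sum>l<k. g l * a ^ (k - Suc l) * a)"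
    by (intro sum.cong) simp_all
  then show ?thesis by (simp add: sum_distrib_right)
qed

lemma runs_horner:
  assumes "nreg s ''m'' = m" "1 \<le> m"
  shows "runs horner s (30 * m)
    (\<lambda>s'. rreg s' ''v'' = (\<Sum>l<m. (rarr s ''c'' l * rarr s ''S'' l) * rreg s ''a'' ^ (m - 1 - l)))"
proof -
  let ?I = "\<lambda>k s'. rreg s' ''v'' = (\<Sum>l<k. (rarr s ''c'' l * rarr s ''S'' l) * rreg s ''a'' ^ (k - 1 - l))"
  show ?thesis unfolding horner_def
    apply simp
    apply (intro conjI)
    using assms apply simp
    apply (rule runs_For[where I = ?I and T = 12 and N = m])
    using assms apply (auto simp: frameD horner_step simp del: sum.lessThan_Suc)
    done
qed

text \<open>There is no conversion from naturals to reals, so \<open>p\<close> is first counted up in the register \<open>e\<close>.\<close>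

definition signed_binomials :: com where
  "signed_binomials =
     RAssign ''e'' (RConst 0) ;; For ''l'' ''p'' (RAssign ''e'' (RAdd (RReg ''e'') (RConst 1))) ;;
     RPut ''c'' (NConst 0) (RConst 1) ;; RAssign ''f'' (RConst 0) ;;
     For ''l'' ''p''
       (RPut ''c'' (NAdd (NReg ''l'') (NConst 1))
          (RDiv (RMul (RGet ''c'' (NReg ''l'')) (RSub (RReg ''f'') (RReg ''e'')))
             (RAdd (RReg ''f'') (RConst 1))) ;;
        RAssign ''f'' (RAdd (RReg ''f'') (RConst 1)))"

lemma modifies_signed_binomials [simp]:
  "nregs_of signed_binomials = {''l''}" "rregs_of signed_binomials = {''e'', ''f''}"
  "narrs_of signed_binomials = {}" "rarrs_of signed_binomials = {''c''}"
  by (auto simp: signed_binomials_def)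

text \<open>By absorption, \<open>Suc k * (p choose Suc k) = (p choose k) * (p - k)\<close>. The
  program multiplies by \<open>k - p\<close> instead, which is negative and so produces the
  alternating sign.\<close>

lemma signed_binomial_step:
  assumes "k < p"
  shows "(-1) ^ k * real (p choose k) * (real k - real p) / (real k + 1) =
    - ((-1) ^ k * real (p choose Suc k))"
proof -
  have "Suc k * (p choose Suc k) = (p choose k) * (p - k)"
    using binomial_absorption[of k p] binomial_absorb_comp[of p k] by (simp add: mult.commute)
  then have "real (Suc k * (p choose Suc k)) = real ((p choose k) * (p - k))" by simp
  then have "real (p choose k) * (real k - real p) = - real (p choose Suc k) * (real k + 1)"
    using assms by (simp add: algebra_simps of_nat_diff)
  then have "(-1) ^ k * (real (p choose k) * (real k - real p)) =
      - ((-1) ^ k * real (p choose Suc k)) * (real k + 1)" by simp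
  then show ?thesis by (simp add: divide_eq_eq mult.assoc)
qed

lemma runs_signed_binomials:
  assumes "nreg s ''p'' = p" "1 \<le> p"
  shows "runs signed_binomials s (100 * p)
    (\<lambda>s'. \<forall>l\<le>p. rarr s' ''c'' l = (-1) ^ l * real (p choose l))"
proof -
  \<comment> \<open>Entry 0 is stored before the loop, so \<open>p\<close> rounds yield
    \<open>p + 1\<close> coefficients.\<close>
  let ?I = "\<lambda>k s'. rreg s' ''f'' = real k \<and> (\<forall>l\<le>k. rarr s' ''c'' l = (-1) ^ l * real (p choose l))"
  have count: "runs (For ''l'' ''p'' (RAssign ''e'' (RAdd (RReg ''e'') (RConst 1)))) s' (18 * p)
      (\<lambda>s. rreg s ''e'' = real p)"
    if "nreg s' ''p'' = p" "rreg s' ''e'' = 0" for s'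
    by (rule runs_For[where I = "\<lambda>k s. rreg s ''e'' = real k" and T = 4 and N = p])
      (use that assms in \<open>auto simp: frameD\<close>)
  show ?thesis unfolding signed_binomials_def
    apply simp
    apply (intro conjI)
    using assms apply simp
    apply (rule runs_Seq[where U = "60 * p", OF count])
    using assms apply (simp_all add: frameD)
    apply (intro conjI)
    apply linarith
    apply (rule runs_For[where I = ?I and T = 18 and N = p])
    using assms apply (auto simp: frameD le_Suc_eq signed_binomial_step)
    done
qed

text \<open>Binomial theorem for \<open>(- f i + a) ^ p\<close>. Exchanging the sums over
  \<open>i\<close> and \<open>l\<close> separates the moments, which are common to all evaluation
  points, from the powers of \<open>a\<close>.\<close>

lemma binomial_moments:
  fixes a :: real
  assumes c: "\<And>l. l \<le> p \<Longrightarrow> c l = (-1) ^ l * real (p choose l)"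
    and S: "\<And>l. l \<le> p \<Longrightarrow> S l = (\<Sum>i<n. e i * f i ^ l)"
  shows "(\<Sum>l<Suc p. c l * S l * a ^ (p - l)) = (\<Sum>i<n. e i * (a - f i) ^ p)"
proof -
  have "(\<Sum>l<Suc p. c l * S l * a ^ (p - l)) =
      (\<Sum>l\<le>p. \<Sum>i<n. e i * (of_nat (p choose l) * (- f i) ^ l * a ^ (p - l)))"
    unfolding lessThan_Suc_atMost
  proof (intro sum.cong refl)
    fix l assume "l \<in> {..p}"
    then have "l \<le> p" by simp
    show "c l * S l * a ^ (p - l) =
        (\<Sum>i<n. e i * (of_nat (p choose l) * (- f i) ^ l * a ^ (p - l)))"
      unfolding c[OF \<open>l \<le> p\<close>] S[OF \<open>l \<le> p\<close>] sum_distrib_left sum_distrib_right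
      by (intro sum.cong refl) (simp add: power_minus[of "f _"] mult_ac)
  qed
  also have "\<dots> = (\<Sum>i<n. \<Sum>l\<le>p. e i * (of_nat (p choose l) * (- f i) ^ l * a ^ (p - l)))"
    by (rule sum.swap)
  also have "\<dots> = (\<Sum>i<n. e i * (- f i + a) ^ p)"
    unfolding binomial_ring sum_distrib_left ..
  finally show ?thesis by simp
qed

section \<open>Absolute powers from signs along a sorted order\<close>

definition sorting :: "nat \<Rightarrow> (nat \<Rightarrow> real) \<Rightarrow> (nat \<Rightarrow> nat) \<Rightarrow> bool" where
  "sorting n f \<pi> \<longleftrightarrow> \<pi> ` {..<n} = {..<n} \<and> (\<forall>h h'. h \<le> h' \<longrightarrow> h' < n \<longrightarrow> f (\<pi> h) \<le> f (\<pi> h'))"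

definition signs :: "nat \<Rightarrow> real \<Rightarrow> real \<Rightarrow> bool" where
  "signs p \<sigma> \<tau> \<longleftrightarrow> (if even p then \<sigma> = 1 \<and> \<tau> = 0 else \<sigma> = -1 \<and> \<tau> = 2)"

text \<open>For odd \<open>p\<close>, the points visited up to and including step \<open>h\<close>
  carry sign 1 and satisfy \<open>f i \<le> f (\<pi> h)\<close>; all others carry -1 and satisfy the
  converse inequality. Ties may fall on either side, as the difference vanishes there.\<close>

lemma signed_power:
  assumes "signs p \<sigma> \<tau>" and "odd p \<Longrightarrow> sorting n f \<pi>" and im: "\<pi> ` {..<n} = {..<n}"
    and "h < n" "i < n"
  shows "(\<sigma> + (if i \<in> \<pi> ` {..<Suc h} then \<tau> else 0)) * (f (\<pi> h) - f i) ^ p = \<bar>f (\<pi> h) - f i\<bar> ^ p"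
proof (cases "even p")
  case True
  then show ?thesis using assms(1) by (simp add: signs_def power_even_abs)
next
  case False
  then have srt: "\<And>h h'. h \<le> h' \<Longrightarrow> h' < n \<Longrightarrow> f (\<pi> h) \<le> f (\<pi> h')" and st: "\<sigma> = -1" "\<tau> = 2"
    using assms by (auto simp: sorting_def signs_def)
  obtain g where g: "g < n" "i = \<pi> g" using im \<open>i < n\<close> by (auto simp: image_iff set_eq_iff)
  show ?thesis
  proof (cases "i \<in> \<pi> ` {..<Suc h}")
    case True
    then obtain g' where "g' \<le> h" "i = \<pi> g'" by (auto simp: less_Suc_eq_le)
    then have "f i \<le> f (\<pi> h)" using srt \<open>h < n\<close> by simp
    then show ?thesis using True st by simp
  next
    case False
    then have "\<not> g < Suc h" using g by blast
    then have "f (\<pi> h) \<le> f i" using srt g by simp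
    then have "\<bar>f (\<pi> h) - f i\<bar> = - (f (\<pi> h) - f i)" by simp
    then have "\<bar>f (\<pi> h) - f i\<bar> ^ p = - ((f (\<pi> h) - f i) ^ p)"
      by (simp only: power_minus_odd[OF \<open>odd p\<close>])
    then show ?thesis using False st by simp
  qed
qed

definition abs_power_sum :: "nat \<Rightarrow> nat \<Rightarrow> (nat \<Rightarrow> real) \<Rightarrow> (nat \<Rightarrow> real) \<Rightarrow> nat \<Rightarrow> real" where
  "abs_power_sum p n z f i = (\<Sum>j<n. z j * \<bar>f i - f j\<bar> ^ p)"

text \<open>The machine has no remainder operation; toggling \<open>p\<close> times costs O(p),
  which a query can afford.\<close>

definition parity :: com where
  "parity = NAssign ''o'' (NConst 0) ;;
     For ''i'' ''p'' (NAssign ''o'' (NSub (NConst 1) (NReg ''o'')))"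

lemma modifies_parity [simp]:
  "nregs_of parity = {''o'', ''i''}" "rregs_of parity = {}" "narrs_of parity = {}" "rarrs_of parity = {}"
  by (auto simp: parity_def)

lemma runs_parity:
  assumes "nreg s ''p'' = p" "1 \<le> p"
  shows "runs parity s (20 * p) (\<lambda>s'. nreg s' ''o'' = p mod 2)"
  unfolding parity_def
  apply simp
  apply (intro conjI)
  using assms apply simp
  apply (rule runs_For[where I = "\<lambda>k s. nreg s ''o'' = k mod 2" and T = 4 and N = p])
  using assms apply (auto simp: mod_Suc)
  done

definition coord :: "name \<Rightarrow> rexp" where
  "coord i = RGet ''X'' (NAdd (NGet ''row'' (NReg i)) (NReg ''k''))"

lemma rcost_coord [simp]: "rcost (coord i) = 5"
  by (simp add: coord_def)

definition moments :: com where
  "moments =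
     For ''l'' ''m'' (RPut ''S'' (NReg ''l'') (RConst 0)) ;;
     For ''i'' ''n''
       (RAssign ''a'' (coord ''i'') ;;
        RAssign ''w'' (RMul (RReg ''sigma'') (RGet ''z'' (NReg ''i''))) ;;
        add_powers)"

lemma modifies_moments [simp]:
  "nregs_of moments = {''l'', ''i''}" "rregs_of moments = {''a'', ''w''}"
  "narrs_of moments = {}" "rarrs_of moments = {''S''}"
  by (auto simp: moments_def)

text \<open>The points enter only through the values \<open>f i\<close> of one coordinate; the
  premise on \<open>coord\<close> hides the memory layout.\<close>

lemma runs_moments:
  assumes m: "nreg s ''m'' = m" "1 \<le> m" and n: "nreg s ''n'' = n" "1 \<le> n"
    and f: "\<And>i. i < n \<Longrightarrow> rval (coord ''i'') (s\<lparr>nreg := (nreg s)(''i'' := i)\<rparr>) = f i"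
  shows "runs moments s (80 * (n * m))
    (\<lambda>s'. \<forall>l<m. rarr s' ''S'' l = (\<Sum>i<n. rreg s ''sigma'' * rarr s ''z'' i * f i ^ l))"
proof -
  let ?I = "\<lambda>k s'. \<forall>l<m. rarr s' ''S'' l = (\<Sum>i<k. rreg s ''sigma'' * rarr s ''z'' i * f i ^ l)"
  have clear: "runs (For ''l'' ''m'' (RPut ''S'' (NReg ''l'') (RConst 0))) s (17 * m)
      (\<lambda>s'. \<forall>l<m. rarr s' ''S'' l = 0)"
    by (rule runs_For[where I = "\<lambda>k s'. \<forall>l<k. rarr s' ''S'' l = 0" and T = 3 and N = m])
      (use m in \<open>auto simp: less_Suc_eq\<close>)
  have nm: "n \<le> n * m" "m \<le> n * m" using m n by auto
  show ?thesis unfolding moments_def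
  proof (rule runs_Seq[OF clear, where U = "n * (41 * m + 14)"], goal_cases)
    case (1 s1)
    show ?case
    proof (rule runs_For[where I = ?I and T = "41 * m" and N = n], goal_cases)
      case (7 i s2)
      have fi: "rval (coord ''i'') s2 = f i"
        using 7 1 f[of i] by (simp add: frameD coord_def)
      show ?case
        using m(2) 7 1 apply (simp add: fi)
        apply (intro conjI)
        apply linarith
        apply (rule runs_conseq[OF runs_add_powers[where m = m]])
        using m apply (auto simp: frameD)
        done
    qed (use 1 n in \<open>auto simp: frameD\<close>)
  next
    case 2
    have "n * (41 * m + 14) = 41 * (n * m) + 14 * n" by (simp add: algebra_simps)
    then show ?case using nm by linarith
  qed
qed

text \<open>For even \<open>p\<close> the visiting order is the identity and \<open>tau\<close> is
  0, so the moments stay fixed. The sign of a point changes before the evaluation at it, in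
  accordance with \<open>Suc h\<close> in \<open>signed_power\<close>. Adding to \<open>y\<close>
  collects the sum over the coordinates.\<close>

definition accumulate :: com where
  "accumulate = For ''h'' ''n''
     (If (NLess (NConst 0) (NReg ''o''))
        (NAssign ''i'' (NGet ''perm'' (NAdd (NReg ''b'') (NReg ''h''))))
        (NAssign ''i'' (NReg ''h'')) ;;
      RAssign ''a'' (coord ''i'') ;;
      RAssign ''w'' (RMul (RReg ''tau'') (RGet ''z'' (NReg ''i''))) ;;
      add_powers ;; horner ;;
      RPut ''y'' (NReg ''i'') (RAdd (RGet ''y'' (NReg ''i'')) (RReg ''v'')))"

lemma modifies_accumulate [simp]:
  "nregs_of accumulate = {''l'', ''i'', ''h''}" "rregs_of accumulate = {''a'', ''w'', ''v''}"
  "narrs_of accumulate = {}" "rarrs_of accumulate = {''S'', ''y''}"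
  by (auto simp: accumulate_def)

lemma runs_accumulate:
  assumes m: "nreg s ''m'' = Suc p" and n: "nreg s ''n'' = n" "1 \<le> n"
    and f: "\<And>i. i < n \<Longrightarrow> rval (coord ''i'') (s\<lparr>nreg := (nreg s)(''i'' := i)\<rparr>) = f i"
    and c: "\<And>l. l \<le> p \<Longrightarrow> rarr s ''c'' l = (-1) ^ l * real (p choose l)"
    and o: "nreg s ''o'' = p mod 2"
    and st: "signs p (rreg s ''sigma'') (rreg s ''tau'')"
    and sorted: "odd p \<Longrightarrow> sorting n f (\<lambda>h. narr s ''perm'' (nreg s ''b'' + h))"
    and S: "\<And>l. l < Suc p \<Longrightarrow> rarr s ''S'' l = (\<Sum>i<n. rreg s ''sigma'' * rarr s ''z'' i * f i ^ l)"
  shows "runs accumulate s (110 * (n * Suc p))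
    (\<lambda>s'. \<forall>i<n. rarr s' ''y'' i = rarr s ''y'' i + abs_power_sum p n (rarr s ''z'') f i)"
proof -
  define \<pi> where "\<pi> = (if odd p then (\<lambda>h. narr s ''perm'' (nreg s ''b'' + h)) else (\<lambda>h. h))"
  have im: "\<pi> ` {..<n} = {..<n}" using sorted by (auto simp: \<pi>_def sorting_def)
  \<comment> \<open>A surjection of a finite set onto itself is injective: each point is visited
    once, so its sign flips once and its entry of \<open>y\<close> grows once.\<close>
  then have inj: "inj_on \<pi> {..<n}" by (intro eq_card_imp_inj_on) auto
  have srt: "odd p \<Longrightarrow> sorting n f \<pi>" using sorted by (simp add: \<pi>_def)
  define z where "z = rarr s ''z''"
  define \<sigma> where "\<sigma> = rreg s ''sigma''"
  define \<tau> where "\<tau> = rreg s ''tau''"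
  \<comment> \<open>\<open>e h i\<close> is the sign that point \<open>i\<close> carries in the
    moments after \<open>h\<close> visits.\<close>
  define e where "e h i = \<sigma> + (if i \<in> \<pi> ` {..<h} then \<tau> else 0)" for h i
  define D where "D = abs_power_sum p n z f"
  let ?I = "\<lambda>h s'. (\<forall>l<Suc p. rarr s' ''S'' l = (\<Sum>i<n. e h i * z i * f i ^ l)) \<and>
     (\<forall>i<n. rarr s' ''y'' i = rarr s ''y'' i + (if i \<in> \<pi> ` {..<h} then D i else 0))"
  have e_Suc: "(\<Sum>i<n. e h i * z i * f i ^ l) + \<tau> * z (\<pi> h) * f (\<pi> h) ^ l =
      (\<Sum>i<n. e (Suc h) i * z i * f i ^ l)" if "h < n" for h l
  proof -
    have ph: "\<pi> h < n" using im that by auto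
    have new: "\<pi> h \<notin> \<pi> ` {..<h}" using inj that by (auto dest: inj_onD)
    have "(\<Sum>i<n. e (Suc h) i * z i * f i ^ l) =
        (\<Sum>i<n. e h i * z i * f i ^ l + (if i = \<pi> h then \<tau> * z i * f i ^ l else 0))"
      using new by (intro sum.cong) (auto simp: e_def lessThan_Suc algebra_simps)
    then show ?thesis using ph by (simp add: sum.distrib)
  qed
  \<comment> \<open>The value left by \<open>horner\<close>: \<open>binomial_moments\<close>
    collapses the moments, and \<open>signed_power\<close> turns signed powers into absolute
    ones.\<close>
  have gain: "(\<Sum>l<Suc p. rarr s ''c'' l * (\<Sum>i<n. e (Suc h) i * z i * f i ^ l) * f (\<pi> h) ^ (p - l)) =
      D (\<pi> h)" if "h < n" for h
  proof -
    have "(\<Sum>l<Suc p. rarr s ''c'' l * (\<Sum>i<n. e (Suc h) i * z i * f i ^ l) * f (\<pi> h) ^ (p - l)) =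
        (\<Sum>i<n. e (Suc h) i * z i * (f (\<pi> h) - f i) ^ p)"
      by (rule binomial_moments[OF c]) auto
    also have "\<dots> = (\<Sum>i<n. z i * \<bar>f (\<pi> h) - f i\<bar> ^ p)"
    proof (intro sum.cong refl)
      fix i assume "i \<in> {..<n}"
      then have "e (Suc h) i * (f (\<pi> h) - f i) ^ p = \<bar>f (\<pi> h) - f i\<bar> ^ p"
        unfolding e_def \<sigma>_def \<tau>_def by (intro signed_power[OF st srt im that]) auto
      then show "e (Suc h) i * z i * (f (\<pi> h) - f i) ^ p = z i * \<bar>f (\<pi> h) - f i\<bar> ^ p"
        by (metis mult.assoc mult.commute)
    qed
    finally show ?thesis by (simp add: D_def abs_power_sum_def)
  qed
  show ?thesis unfolding accumulate_def
  proof (rule runs_For[where I = ?I and T = "90 * Suc p" and N = n], goal_cases)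
    case (7 h s1)
    have ph: "\<pi> h < n" using im 7 by auto
    have new: "\<pi> h \<notin> \<pi> ` {..<h}" using inj 7 by (auto dest: inj_onD)
    have fi: "rval (coord ''i'') (s1\<lparr>nreg := (nreg s1)(''i'' := \<pi> h)\<rparr>) = f (\<pi> h)"
      using 7 f[OF ph] by (simp add: frameD coord_def)
    let ?If = "If (NLess (NConst 0) (NReg ''o''))
        (NAssign ''i'' (NGet ''perm'' (NAdd (NReg ''b'') (NReg ''h''))))
        (NAssign ''i'' (NReg ''h''))"
    have idx: "runs ?If s1 10 (\<lambda>s'. s' = s1\<lparr>nreg := (nreg s1)(''i'' := \<pi> h)\<rparr>)"
      using 7 o by (auto simp: frameD \<pi>_def odd_iff_mod_2_eq_one)
    show ?case
    proof (rule runs_Seq[OF idx, where U = "80 * Suc p"], goal_cases)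
      case (1 s2)
      note fr = 7(2)
      have s2: "nreg s2 ''m'' = Suc p" "nreg s2 ''i'' = \<pi> h" "rarr s2 ''S'' = rarr s1 ''S''" 
         "rreg s2 ''tau'' = \<tau>" "rarr s2 ''z'' = z" "rarr s2 ''y'' = rarr s1 ''y''" "rarr s2 ''c'' = rarr s ''c''"
        using 1(2) m fr by (simp_all add: frameD[OF fr] \<tau>_def z_def)
      have fi: "rval (coord ''i'') s2 = f (\<pi> h)" using fi 1(2) by simp
      show ?case
        apply (simp add: fi)
        apply (rule runs_Seq[where U = "36 * Suc p", OF runs_add_powers[where m = "Suc p"]])
        using s2 apply simp
        apply simp
        apply (rule runs_Seq[where U = "6 * Suc p", OF runs_horner[where m = "Suc p"]])
        using s2 apply (simp add: frameD)
        apply simp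
        using 7(4) s2 ph new
        apply (simp add: frameD e_Suc[OF 7(1)] gain[OF 7(1)] del: sum.lessThan_Suc)
        apply (auto simp: frameD lessThan_Suc)
        done
    next
      case 2
      then show ?case by simp
    qed
  qed (use S n in \<open>auto simp: add_mult_distrib2 frameD e_def z_def \<sigma>_def D_def im\<close>)
qed

section \<open>Answering a query\<close>

text \<open>Memory survives between queries; \<open>loaded\<close> and \<open>ordered\<close> are what every query relies on and preserves.\<close>

definition loaded :: "nat \<Rightarrow> nat \<Rightarrow> nat \<Rightarrow> (nat \<Rightarrow> real vec) \<Rightarrow> state \<Rightarrow> bool" where
  "loaded n d p x s \<longleftrightarrow> nreg s ''n'' = n \<and> nreg s ''d'' = d \<and> nreg s ''p'' = p \<and>
     (\<forall>i<n. \<forall>k<d. rarr s ''X'' (i * d + k) = x i $ k)"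

definition ordered :: "nat \<Rightarrow> nat \<Rightarrow> (nat \<Rightarrow> real vec) \<Rightarrow> state \<Rightarrow> bool" where
  "ordered n d x s \<longleftrightarrow>
     (\<forall>k<d. sorting n (\<lambda>i. x i $ k) (\<lambda>h. narr s ''perm'' (k * n + h)))"

text \<open>All this is redone for each query: for even \<open>p\<close> the first query starts from
  the bare input, and \<open>y\<close> still holds the previous answer when a further one is
  posed.\<close>

definition prepare :: com where
  "prepare = rows ;; parity ;; signed_binomials ;;
     For ''i'' ''n'' (RPut ''y'' (NReg ''i'') (RConst 0)) ;;
     NAssign ''m'' (NAdd (NReg ''p'') (NConst 1)) ;;
     NAssign ''b'' (NConst 0) ;;
     If (NLess (NConst 0) (NReg ''o''))
       (RAssign ''sigma'' (RConst (-1)) ;; RAssign ''tau'' (RConst 2))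
       (RAssign ''sigma'' (RConst 1) ;; RAssign ''tau'' (RConst 0))"

lemma modifies_prepare [simp]:
  "nregs_of prepare = {''q'', ''i'', ''o'', ''m'', ''l'', ''b''}"
  "rregs_of prepare = {''e'', ''f'', ''sigma'', ''tau''}"
  "narrs_of prepare = {''row''}" "rarrs_of prepare = {''c'', ''y''}"
  by (auto simp: prepare_def)

lemma runs_prepare:
  assumes s: "nreg s ''n'' = n" "nreg s ''p'' = p" and np: "1 \<le> n" "1 \<le> p"
  shows "runs prepare s (50 * n + 150 * p) (\<lambda>s'.
    (\<forall>i<n. narr s' ''row'' i = i * nreg s ''d'') \<and> nreg s' ''o'' = p mod 2 \<and>
    nreg s' ''m'' = Suc p \<and> nreg s' ''b'' = 0 \<and> signs p (rreg s' ''sigma'') (rreg s' ''tau'') \<and>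
    (\<forall>l\<le>p. rarr s' ''c'' l = (-1) ^ l * real (p choose l)) \<and> (\<forall>i<n. rarr s' ''y'' i = 0))"
proof -
  have clear: "runs (For ''i'' ''n'' (RPut ''y'' (NReg ''i'') (RConst 0))) s' (17 * n)
      (\<lambda>s'. \<forall>i<n. rarr s' ''y'' i = 0)" if "nreg s' ''n'' = n" for s'
    by (rule runs_For[where I = "\<lambda>k s'. \<forall>i<k. rarr s' ''y'' i = 0" and T = 3 and N = n])
      (use that np in \<open>auto simp: less_Suc_eq\<close>)
  show ?thesis unfolding prepare_def
    apply (rule runs_Seq[OF runs_rows[where n = n], where U = "20 * n + 150 * p"])
    using s np apply (simp_all add: frameD)
    apply (rule runs_Seq[OF runs_parity[where p = p], where U = "20 * n + 130 * p"])
    using s np apply (simp_all add: frameD)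
    apply (rule runs_Seq[OF runs_signed_binomials[where p = p], where U = "20 * n + 30 * p"])
    using s np apply (simp_all add: frameD)
    apply (rule runs_Seq[OF clear, where U = "3 * n + 30 * p"])
    using s np apply (simp_all add: frameD)
    apply (auto simp: frameD signs_def odd_iff_mod_2_eq_one even_iff_mod_2_eq_zero)
    done
qed

definition query :: com where
  "query = prepare ;; For ''k'' ''d''
     (moments ;; accumulate ;; NAssign ''b'' (NAdd (NReg ''b'') (NReg ''n'')))"

lemma modifies_query [simp]:
  "nregs_of query = {''q'', ''i'', ''o'', ''m'', ''l'', ''b'', ''k'', ''h''}"
  "rregs_of query = {''e'', ''f'', ''sigma'', ''tau'', ''a'', ''w'', ''v''}"
  "narrs_of query = {''row''}" "rarrs_of query = {''c'', ''y'', ''S''}"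
  by (auto simp: query_def)

lemma runs_query:
  assumes pos: "1 \<le> n" "1 \<le> d" "1 \<le> p" and l: "loaded n d p x s"
    and ord: "odd p \<Longrightarrow> ordered n d x s"
  shows "runs query s (700 * (n * d * p)) (\<lambda>s'. \<forall>i<n. rarr s' ''y'' i =
    (\<Sum>k<d. abs_power_sum p n (rarr s ''z'') (\<lambda>i. x i $ k) i))"
proof -
  define z where "z = rarr s ''z''"
  define m where "m = Suc p"
  let ?I = "\<lambda>k s'. nreg s' ''b'' = k * n \<and> (\<forall>i<n. rarr s' ''y'' i =
    (\<Sum>k<k. abs_power_sum p n z (\<lambda>i. x i $ k) i))"
  have s: "nreg s ''n'' = n" "nreg s ''d'' = d" "nreg s ''p'' = p"
    and X: "\<And>i k. i < n \<Longrightarrow> k < d \<Longrightarrow> rarr s ''X'' (i * d + k) = x i $ k"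
    using l by (auto simp: loaded_def)
  have le: "n \<le> n * d * p" "p \<le> n * d * p" "n * d \<le> n * d * p" "d \<le> n * d * p"
    using pos by auto
  have nm: "1 \<le> n * m" using pos by (simp add: m_def)
  show ?thesis unfolding query_def
  \<comment> \<open>Per coordinate, in units of \<open>n * m\<close>: 80 for \<open>moments\<close>,
    110 for \<open>accumulate\<close> and at most 4 for advancing \<open>b\<close>, together 194.
    The 14 is the loop overhead.\<close>
  proof (rule runs_Seq[OF runs_prepare[where n = n and p = p], where U = "d * (194 * (n * m) + 14)"], goal_cases)
    case (5 s1)
    then have s1: "\<And>i. i < n \<Longrightarrow> narr s1 ''row'' i = i * d" "nreg s1 ''o'' = p mod 2"
      "nreg s1 ''m'' = m" "nreg s1 ''b'' = 0" "signs p (rreg s1 ''sigma'') (rreg s1 ''tau'')"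
      "\<And>l. l \<le> p \<Longrightarrow> rarr s1 ''c'' l = (-1) ^ l * real (p choose l)"
      "\<And>i. i < n \<Longrightarrow> rarr s1 ''y'' i = 0"
      "nreg s1 ''n'' = n" "nreg s1 ''d'' = d" "rarr s1 ''z'' = z" "rarr s1 ''X'' = rarr s ''X''"
      "narr s1 ''perm'' = narr s ''perm''"
      by (simp_all add: frameD s z_def m_def)
    show ?case
    proof (rule runs_For[where I = ?I and T = "194 * (n * m)" and N = d], goal_cases)
      case (7 k s2)
      note fr = frameD[OF 7(2)]
      let ?f = "\<lambda>i. x i $ k"
      have s2: "\<And>i. i < n \<Longrightarrow> narr s2 ''row'' i = i * d" "nreg s2 ''o'' = p mod 2"
        "nreg s2 ''m'' = m" "nreg s2 ''b'' = k * n" "signs p (rreg s2 ''sigma'') (rreg s2 ''tau'')"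
        "\<And>l. l \<le> p \<Longrightarrow> rarr s2 ''c'' l = (-1) ^ l * real (p choose l)"
        "nreg s2 ''n'' = n" "rarr s2 ''z'' = z" "rarr s2 ''X'' = rarr s ''X''"
        "narr s2 ''perm'' = narr s ''perm''" "nreg s2 ''k'' = k"
        using s1 7 by (simp_all add: fr)
      show ?case
      proof (rule runs_Seq[OF runs_moments[where n = n and m = m and f = ?f], where U = "114 * (n * m)"], goal_cases)
        case (6 s3)
        note fr3 = frameD[OF 6(1)]
        show ?case
        proof (rule runs_Seq[OF runs_accumulate[where n = n and p = p and f = ?f], where U = "4 * (n * m)"], goal_cases)
          case (10 s4)
          then show ?case using 7 s2 by (simp add: fr3 frameD) (use nm in linarith)
        qed (use s2 6 pos ord X 7 in \<open>auto simp: fr3 m_def ordered_def coord_def\<close>)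
      qed (use s2 pos X 7 in \<open>auto simp: m_def coord_def\<close>)
    qed (use s1 pos z_def in auto)
  next
    case 6
    \<comment> \<open>The main term becomes 388 times \<open>n * d * p\<close>. The remaining
      \<open>14 * d + 50 * n + 150 * p\<close> adds at most 214 such units, within the 700
      allowed.\<close>
    have "m \<le> 2 * p" using pos by (simp add: m_def)
    then have "d * (194 * (n * m)) \<le> d * (194 * (n * (2 * p)))" by (intro mult_le_mono le_refl)
    also have "\<dots> = 388 * (n * d * p)" by simp
    finally show ?case unfolding add_mult_distrib2 using le by linarith
  qed (use s pos in auto)
qed

section \<open>Bottom-up merge sort\<close>

definition blockwise :: "nat \<Rightarrow> nat \<Rightarrow> (nat \<Rightarrow> real) \<Rightarrow> bool" where
  "blockwise n w f \<longleftrightarrow> (\<forall>h h'. h \<le> h' \<longrightarrow> h' < n \<longrightarrow> h div w = h' div w \<longrightarrow> f h \<le> f h')"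

text \<open>
  The invariant of a merge pass that has written \<open>q\<close> cells of \<open>v\<close> and is merging, inside block \<open>t\<close> of
  width \<open>2 * w\<close>, the remaining runs \<open>[i, mid)\<close> and \<open>[j, hi)\<close> of \<open>u\<close>. The bounds \<open>mid\<close> and \<open>hi\<close> are
  not clipped to \<open>n\<close>.
\<close>

definition merging :: "nat \<Rightarrow> nat \<Rightarrow> (nat \<Rightarrow> real) \<Rightarrow> (nat \<Rightarrow> nat) \<Rightarrow> (nat \<Rightarrow> nat) \<Rightarrow>
    nat \<Rightarrow> nat \<Rightarrow> nat \<Rightarrow> nat \<Rightarrow> nat \<Rightarrow> nat \<Rightarrow> bool" where
  "merging n w f u v q t i mid j hi \<longleftrightarrow>
     mid = t * (2 * w) + w \<and> hi = mid + w \<and> t * (2 * w) \<le> i \<and> i \<le> mid \<and> mid \<le> j \<and> j \<le> hi \<and>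
     q + mid = i + j \<and> (j \<le> n \<or> j = mid) \<and>
     v ` {..<q} = u ` ({..<i} \<union> {mid..<j}) \<and>
     blockwise q (2 * w) (f \<circ> v) \<and>
     (\<forall>h g. t * (2 * w) \<le> h \<longrightarrow> h < q \<longrightarrow> i \<le> g \<and> g < mid \<or> j \<le> g \<and> g < hi \<longrightarrow> g < n \<longrightarrow>
        f (v h) \<le> f (u g))"

lemma merging_start:
  "merging n w f u v 0 0 0 w w (w + w)"
  by (auto simp: merging_def blockwise_def)

text \<open>As \<open>i \<le> mid\<close> and \<open>j \<le> hi\<close>, the count
  \<open>q + mid = i + j\<close> with \<open>q\<close> not below \<open>hi\<close> forces
  \<open>i = mid\<close> and \<open>j = hi\<close>: both runs are used up and the next block starts
  at \<open>q\<close>.\<close>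

lemma merging_new_block:
  assumes "merging n w f u v q t i mid j hi" and "\<not> q < hi"
  shows "merging n w f u v q (Suc t) q (q + w) (q + w) (q + w + w)"
proof -
  have eq: "i = mid" "j = hi" "q = hi" "hi = Suc t * (2 * w)"
    using assms by (auto simp: merging_def)
  then have "{..<i} \<union> {mid..<j} = {..<hi}" "mid \<le> hi" using assms by (auto simp: merging_def)
  then show ?thesis using assms eq by (auto simp: merging_def)
qed

text \<open>Shared by both choices: the element moved is minimal among the pending ones. When
  \<open>i = mid = j\<close>, the equation \<open>c = i\<close> does not tell which run is consumed;
  hence the test \<open>i < mid\<close> in the last premise.\<close>

lemma merging_advance:
  assumes M: "merging n w f u v q t i mid j hi" and q: "q < n" "q < hi"
    and le: "\<And>g. i \<le> g \<and> g < mid \<or> j \<le> g \<and> g < hi \<Longrightarrow> g < n \<Longrightarrow> f (u c) \<le> f (u g)"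
    and c: "c < n" "c = i \<and> i < mid \<or> c = j \<and> j < hi"
    and ij: "if c = i \<and> i < mid then i' = Suc i \<and> j' = j else i' = i \<and> j' = Suc j"
  shows "merging n w f u (v(q := u c)) (Suc q) t i' mid j' hi"
proof -
  let ?v = "v(q := u c)"
  have M': "mid = t * (2 * w) + w" "hi = mid + w" "t * (2 * w) \<le> i" "i \<le> mid" "mid \<le> j" "j \<le> hi"
     "q + mid = i + j" "j \<le> n \<or> j = mid" "v ` {..<q} = u ` ({..<i} \<union> {mid..<j})"
     and bw: "\<And>h h'. h \<le> h' \<Longrightarrow> h' < q \<Longrightarrow> h div (2 * w) = h' div (2 * w) \<Longrightarrow> f (v h) \<le> f (v h')"
     and low: "\<And>h g. t * (2 * w) \<le> h \<Longrightarrow> h < q \<Longrightarrow> i \<le> g \<and> g < mid \<or> j \<le> g \<and> g < hi \<Longrightarrow> g < n \<Longrightarrow>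
        f (v h) \<le> f (u g)"
    using M unfolding merging_def blockwise_def comp_def by blast+
  have "w > 0" using M' q by (cases w) auto
  have ij': "i' + j' = Suc (i + j)" "t * (2 * w) \<le> i'" "i' \<le> mid" "mid \<le> j'" "j' \<le> hi" "j' \<le> n \<or> j' = mid"
    "i \<le> i'" "j \<le> j'"
    using ij c M' by (auto split: if_splits)
  have sets: "{..<i'} \<union> {mid..<j'} = insert c ({..<i} \<union> {mid..<j})"
    using ij c M' by (auto split: if_splits)
  have "?v ` {..<Suc q} = insert (u c) (v ` {..<q})"
    by (auto simp: lessThan_Suc)
  also have "\<dots> = u ` ({..<i'} \<union> {mid..<j'})" unfolding sets M'(9) by simp
  finally have im: "?v ` {..<Suc q} = u ` ({..<i'} \<union> {mid..<j'})" .
  have qlow: "t * (2 * w) \<le> q" using M' by linarith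
  have qdiv: "q div (2 * w) = t"
    using qlow q M' \<open>w > 0\<close> by (intro div_nat_eqI) (auto simp: algebra_simps)
  \<comment> \<open>\<open>c\<close> itself is pending, so \<open>low\<close> at \<open>c\<close>
    places the earlier entries of block \<open>t\<close> below the new one.\<close>
  have cg: "i \<le> c \<and> c < mid \<or> j \<le> c \<and> c < hi" using c by auto
  have "f (?v h) \<le> f (?v h')" if "h \<le> h'" "h' < Suc q" "h div (2 * w) = h' div (2 * w)" for h h'
  proof (cases "h' = q \<and> h < q")
    case True
    then have "h div (2 * w) = t" using that qdiv by simp
    then have "t * (2 * w) \<le> h" by (metis div_times_less_eq_dividend)
    then show ?thesis using low[OF _ _ cg \<open>c < n\<close>] True by auto
  next
    case False
    then show ?thesis using that bw by (auto simp: less_Suc_eq)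
  qed
  then have bw': "blockwise (Suc q) (2 * w) (f \<circ> ?v)" by (simp add: blockwise_def)
  have "f (?v h) \<le> f (u g)"
    if "t * (2 * w) \<le> h" "h < Suc q" "i' \<le> g \<and> g < mid \<or> j' \<le> g \<and> g < hi" "g < n" for h g
  proof -
    have g: "i \<le> g \<and> g < mid \<or> j \<le> g \<and> g < hi" using that ij' by linarith
    show ?thesis using low[OF that(1) _ g \<open>g < n\<close>] le[OF g \<open>g < n\<close>] that(2)
      by (auto simp: less_Suc_eq)
  qed
  then show ?thesis
    unfolding merging_def using M' ij' im bw' by auto
qed

text \<open>The left run lies in block \<open>2 * t\<close> of width \<open>w\<close> and the right
  run in block \<open>2 * t + 1\<close>. Each is nondecreasing, so the smaller of the two heads is
  minimal among all pending elements.\<close>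

lemma merging_step:
  assumes M: "merging n w f u v q t i mid j hi" and q: "q < n" "q < hi"
    and bw: "blockwise n w (f \<circ> u)"
  shows "i < mid \<and> \<not> (j < hi \<and> j < n \<and> f (u j) < f (u i)) \<Longrightarrow>
      merging n w f u (v(q := u i)) (Suc q) t (Suc i) mid j hi"
    and "\<not> (i < mid \<and> \<not> (j < hi \<and> j < n \<and> f (u j) < f (u i))) \<Longrightarrow>
      merging n w f u (v(q := u j)) (Suc q) t i mid (Suc j) hi"
proof -
  have M': "mid = t * (2 * w) + w" "hi = mid + w" "t * (2 * w) \<le> i" "i \<le> mid" "mid \<le> j" "j \<le> hi"
     "q + mid = i + j" "j \<le> n \<or> j = mid"
    using M unfolding merging_def by blast+
  have "w > 0" using M' q by (cases w) auto
  have left: "f (u a) \<le> f (u g)" if "i \<le> a" "a \<le> g" "g < mid" "g < n" for a g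
  proof -
    have "a div w = 2 * t" "g div w = 2 * t"
      using that M' by (auto intro!: div_nat_eqI simp: algebra_simps)
    then show ?thesis using bw that by (simp add: blockwise_def)
  qed
  have right: "f (u a) \<le> f (u g)" if "j \<le> a" "a \<le> g" "g < hi" "g < n" for a g
  proof -
    have "a div w = 2 * t + 1" "g div w = 2 * t + 1"
      using that M' by (auto intro!: div_nat_eqI simp: algebra_simps)
    then show ?thesis using bw that by (simp add: blockwise_def)
  qed
  show "merging n w f u (v(q := u i)) (Suc q) t (Suc i) mid j hi"
    if 1: "i < mid \<and> \<not> (j < hi \<and> j < n \<and> f (u j) < f (u i))"
  proof (rule merging_advance[OF M q])
    fix g assume g: "i \<le> g \<and> g < mid \<or> j \<le> g \<and> g < hi" "g < n"
    show "f (u i) \<le> f (u g)"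
    proof (cases "i \<le> g \<and> g < mid")
      case True
      then show ?thesis using left g by blast
    next
      case False
      then have "j \<le> g" "g < hi" using g by auto
      then have "f (u j) \<le> f (u g)" using right g by blast
      moreover have "f (u i) \<le> f (u j)" using 1 \<open>j \<le> g\<close> \<open>g < hi\<close> g by auto
      ultimately show ?thesis by simp
    qed
  next
    \<comment> \<open>As \<open>mid \<le> j\<close>, the count \<open>q + mid = i + j\<close> gives
      \<open>i \<le> q\<close>.\<close>
    show "i < n" using M' q by linarith
  qed (use 1 in auto)
  show "merging n w f u (v(q := u j)) (Suc q) t i mid (Suc j) hi"
    if 2: "\<not> (i < mid \<and> \<not> (j < hi \<and> j < n \<and> f (u j) < f (u i)))"
  proof (rule merging_advance[OF M q])
    fix g assume g: "i \<le> g \<and> g < mid \<or> j \<le> g \<and> g < hi" "g < n"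
    show "f (u j) \<le> f (u g)"
    proof (cases "j \<le> g \<and> g < hi")
      case True
      then show ?thesis using right g by blast
    next
      case False
      then have "i \<le> g" "g < mid" using g by auto
      then have "f (u i) \<le> f (u g)" using left g by blast
      moreover have "f (u j) \<le> f (u i)" using 2 \<open>i \<le> g\<close> \<open>g < mid\<close> by auto
      ultimately show ?thesis by simp
    qed
  next
    \<comment> \<open>If the left run is exhausted, \<open>i = mid\<close> gives
      \<open>j = q\<close>; otherwise the failed test itself contains \<open>j < n\<close>. The
      bound \<open>j < hi\<close> follows in the same way.\<close>
    show jn: "j < n" using 2 M' q by linarith
    show "j = i \<and> i < mid \<or> j = j \<and> j < hi" using 2 M' q by linarith
    show "if j = i \<and> i < mid then i = Suc i \<and> Suc j = j else i = i \<and> Suc j = Suc j"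
      using M' by auto
  qed
qed

text \<open>If \<open>j \<le> n\<close>, the count forces \<open>j = n\<close> and
  \<open>i = mid\<close>; if \<open>j = mid\<close>, it gives \<open>i = n\<close>. Either way the
  consumed indices are exactly those below \<open>n\<close>, although \<open>mid\<close> and
  \<open>hi\<close> may lie beyond.\<close>

lemma merging_finish:
  assumes M: "merging n w f u v n t i mid j hi" and "u ` {..<n} = {..<n}"
  shows "v ` {..<n} = {..<n}" and "blockwise n (2 * w) (f \<circ> v)"
proof -
  have M': "i \<le> mid" "mid \<le> j" "n + mid = i + j" "j \<le> n \<or> j = mid"
    "v ` {..<n} = u ` ({..<i} \<union> {mid..<j})"
    using M unfolding merging_def by blast+
  then have "{..<i} \<union> {mid..<j} = {..<n}" by auto
  then show "v ` {..<n} = {..<n}" using M' assms by simp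
  show "blockwise n (2 * w) (f \<circ> v)" using M by (simp add: merging_def)
qed

lemma blockwise_1: "blockwise n 1 f"
  by (simp add: blockwise_def)

text \<open>All indices below \<open>n\<close> have quotient 0 by \<open>w\<close>, so there is a
  single block.\<close>

lemma sorting_iff_blockwise:
  "n \<le> w \<Longrightarrow> sorting n f \<pi> \<longleftrightarrow> \<pi> ` {..<n} = {..<n} \<and> blockwise n w (f \<circ> \<pi>)"
  unfolding sorting_def blockwise_def comp_def
  by (metis div_less le_less_trans less_le_trans)

section \<open>The merge sort program and its running time\<close>

definition new_block :: com where
  "new_block = NAssign ''i'' (NReg ''q'') ;;
     NAssign ''mid'' (NAdd (NReg ''q'') (NReg ''w'')) ;;
     NAssign ''j'' (NReg ''mid'') ;;
     NAssign ''hi'' (NAdd (NReg ''mid'') (NReg ''w''))"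

definition key :: "name \<Rightarrow> rexp" where
  "key i = RGet ''X'' (NAdd (NGet ''row'' (NGet ''u'' (NReg i))) (NReg ''k''))"

lemma rcost_key [simp]: "rcost (key i) = 6"
  by (simp add: key_def)

definition merge_step :: com where
  "merge_step =
     If (NLess (NReg ''q'') (NReg ''hi'')) Skip new_block ;;
     If (And (NLess (NReg ''i'') (NReg ''mid''))
          (Not (And (And (NLess (NReg ''j'') (NReg ''hi'')) (NLess (NReg ''j'') (NReg ''n'')))
             (RLess (key ''j'') (key ''i'')))))
       (NPut ''v'' (NReg ''q'') (NGet ''u'' (NReg ''i'')) ;;
        NAssign ''i'' (NAdd (NReg ''i'') (NConst 1)))
       (NPut ''v'' (NReg ''q'') (NGet ''u'' (NReg ''j'')) ;;
        NAssign ''j'' (NAdd (NReg ''j'') (NConst 1)))"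

definition merge_pass :: com where
  "merge_pass = NAssign ''q'' (NConst 0) ;; new_block ;; For ''q'' ''n'' merge_step ;;
     For ''i'' ''n'' (NPut ''u'' (NReg ''i'') (NGet ''v'' (NReg ''i'')))"

lemma modifies_merge_step [simp]:
  "nregs_of merge_step = {''i'', ''mid'', ''j'', ''hi''}" "rregs_of merge_step = {}"
  "narrs_of merge_step = {''v''}" "rarrs_of merge_step = {}"
  by (auto simp: merge_step_def new_block_def)

lemma modifies_merge_pass [simp]:
  "nregs_of merge_pass = {''i'', ''mid'', ''j'', ''hi'', ''q''}" "rregs_of merge_pass = {}"
  "narrs_of merge_pass = {''v'', ''u''}" "rarrs_of merge_pass = {}"
  by (auto simp: merge_pass_def new_block_def)

abbreviation merging_state :: "nat \<Rightarrow> nat \<Rightarrow> (nat \<Rightarrow> real) \<Rightarrow> (nat \<Rightarrow> nat) \<Rightarrow> nat \<Rightarrow> state \<Rightarrow> bool" where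
  "merging_state n w f u q s \<equiv> \<exists>t. merging n w f u (narr s ''v'') q t
     (nreg s ''i'') (nreg s ''mid'') (nreg s ''j'') (nreg s ''hi'')"

lemma merging_in_range:
  assumes "merging n w f u v q t i mid j hi" "q < n"
  shows "i < mid \<Longrightarrow> i < n"
  using assms unfolding merging_def by linarith

lemma runs_merge_step:
  assumes q: "nreg s ''q'' = q" "q < n" and s: "nreg s ''n'' = n" "nreg s ''w'' = w" "narr s ''u'' = u"
    and w: "1 \<le> w"
    and u: "u ` {..<n} = {..<n}" "blockwise n w (f \<circ> u)"
    and f: "\<And>i. i < n \<Longrightarrow> rarr s ''X'' (narr s ''row'' i + nreg s ''k'') = f i"
    and M: "merging_state n w f u q s"
  shows "runs merge_step s 80 (merging_state n w f u (Suc q))"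
proof -
  let ?pick = "If (And (NLess (NReg ''i'') (NReg ''mid''))
          (Not (And (And (NLess (NReg ''j'') (NReg ''hi'')) (NLess (NReg ''j'') (NReg ''n'')))
             (RLess (key ''j'') (key ''i'')))))
       (NPut ''v'' (NReg ''q'') (NGet ''u'' (NReg ''i'')) ;;
        NAssign ''i'' (NAdd (NReg ''i'') (NConst 1)))
       (NPut ''v'' (NReg ''q'') (NGet ''u'' (NReg ''j'')) ;;
        NAssign ''j'' (NAdd (NReg ''j'') (NConst 1)))"
  have block: "runs (If (NLess (NReg ''q'') (NReg ''hi'')) Skip new_block) s 20
      (\<lambda>s'. merging_state n w f u q s' \<and> q < nreg s' ''hi'')"
    using M q s w by (auto simp: new_block_def dest: merging_new_block)
  show ?thesis unfolding merge_step_def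
  proof (rule runs_Seq[OF block, where U = 50])
    fix s1 assume fr: "frame (If (NLess (NReg ''q'') (NReg ''hi'')) Skip new_block) s s1"
      and "merging_state n w f u q s1 \<and> q < nreg s1 ''hi''"
    then obtain t where M1: "merging n w f u (narr s1 ''v'') q t
        (nreg s1 ''i'') (nreg s1 ''mid'') (nreg s1 ''j'') (nreg s1 ''hi'')"
      and hi: "q < nreg s1 ''hi''" by blast
    have s1: "nreg s1 ''q'' = q" "nreg s1 ''n'' = n" "narr s1 ''u'' = u"
      using q s by (auto simp: frameD[OF fr] new_block_def)
    have key: "rval (key a) s1 = f (u (nreg s1 a))" if "nreg s1 a < n" for a
    proof -
      have "u (nreg s1 a) < n" using u that by auto
      then show ?thesis using f s1 by (simp add: frameD[OF fr] new_block_def key_def)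
    qed
    let ?i = "nreg s1 ''i''" and ?j = "nreg s1 ''j''"
    let ?c = "?i < nreg s1 ''mid'' \<and> \<not> (?j < nreg s1 ''hi'' \<and> ?j < n \<and> f (u ?j) < f (u ?i))"
    note step = merging_step[OF M1 q(2) hi u(2)]
    \<comment> \<open>Evaluation does not short-circuit, so keys may be read out of range. Their
      values matter only under \<open>i < mid\<close>, which implies \<open>i < n\<close>, and
      \<open>j < n\<close>.\<close>
    have c: "(?i < nreg s1 ''mid'' \<and> \<not> ((?j < nreg s1 ''hi'' \<and> ?j < n) \<and>
        rval (key ''j'') s1 < rval (key ''i'') s1)) \<longleftrightarrow> ?c"
      using key merging_in_range[OF M1 q(2)] by auto
    show "runs ?pick s1 50 (merging_state n w f u (Suc q))"
    proof (cases ?c)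
      case True
      with step(1) c s1 show ?thesis by auto
    next
      case False
      with step(2) c s1 show ?thesis by auto
    qed
  qed simp
qed

lemma runs_merge_pass:
  assumes s: "nreg s ''n'' = n" "nreg s ''w'' = w" and w: "1 \<le> w" "1 \<le> n"
    and u: "narr s ''u'' ` {..<n} = {..<n}" "blockwise n w (f \<circ> narr s ''u'')"
    and f: "\<And>i. i < n \<Longrightarrow> rarr s ''X'' (narr s ''row'' i + nreg s ''k'') = f i"
  shows "runs merge_pass s (200 * n)
    (\<lambda>s'. narr s' ''u'' ` {..<n} = {..<n} \<and> blockwise n (2 * w) (f \<circ> narr s' ''u''))"
proof -
  define u where "u = narr s ''u''"
  have u': "u ` {..<n} = {..<n}" "blockwise n w (f \<circ> u)" using u by (auto simp: u_def)
  let ?s0 = "s\<lparr>nreg := (nreg s)(''q'' := 0, ''i'' := 0, ''mid'' := w, ''j'' := w, ''hi'' := w + w)\<rparr>"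
  have merge: "runs (For ''q'' ''n'' merge_step) ?s0 (100 * n) 
      (\<lambda>s'. narr s' ''v'' ` {..<n} = {..<n} \<and> blockwise n (2 * w) (f \<circ> narr s' ''v''))"
  proof (rule runs_For[where I = "merging_state n w f u" and T = 80 and N = n], goal_cases)
    case 6
    show ?case using merging_start[of n w f u "narr s ''v''"] by (intro exI[of _ 0]) simp
  next
    case (7 q s1)
    have "runs merge_step s1 80 (merging_state n w f u (Suc q))"
      using 7 s w u' f by (intro runs_merge_step[where q = q]) (auto simp: frameD u_def)
    then show ?case by (rule runs_conseq) simp_all
  next
    case (8 s1)
    then obtain t where "merging n w f u (narr s1 ''v'') n t
        (nreg s1 ''i'') (nreg s1 ''mid'') (nreg s1 ''j'') (nreg s1 ''hi'')" by (elim exE)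
    from merging_finish[OF this u'(1)] show ?case ..
  qed (use s w in auto)
  have copy: "runs (For ''i'' ''n'' (NPut ''u'' (NReg ''i'') (NGet ''v'' (NReg ''i'')))) s1 (50 * n)
      (\<lambda>s'. \<forall>i<n. narr s' ''u'' i = narr s1 ''v'' i)" if "nreg s1 ''n'' = n" for s1
    by (rule runs_For[where I = "\<lambda>k s'. \<forall>i<k. narr s' ''u'' i = narr s1 ''v'' i" and T = 4 and N = n])
      (use that w in \<open>auto simp: frameD less_Suc_eq\<close>)
  have "runs (For ''q'' ''n'' merge_step ;;
       For ''i'' ''n'' (NPut ''u'' (NReg ''i'') (NGet ''v'' (NReg ''i'')))) ?s0 (150 * n)
     (\<lambda>s'. narr s' ''u'' ` {..<n} = {..<n} \<and> blockwise n (2 * w) (f \<circ> narr s' ''u''))"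
  proof (rule runs_Seq[OF merge, where U = "50 * n"], goal_cases)
    case (1 s1)
    then have "nreg s1 ''n'' = n" using s by (simp add: frameD)
    then show ?case
    proof (rule runs_conseq[OF copy], goal_cases)
      case (2 s2)
      then have "narr s2 ''u'' ` {..<n} = narr s1 ''v'' ` {..<n}" by (intro image_cong) auto
      then show ?case using 1 2 by (auto simp: blockwise_def)
    qed simp
  qed simp
  \<comment> \<open>The assignments before the loop take 14 units; 20 are set aside for them, and
    \<open>150 * n \<le> 200 * n - 20\<close> as \<open>1 \<le> n\<close>.\<close>
  then have "runs (For ''q'' ''n'' merge_step ;;
       For ''i'' ''n'' (NPut ''u'' (NReg ''i'') (NGet ''v'' (NReg ''i'')))) ?s0 (200 * n - 20)
     (\<lambda>s'. narr s' ''u'' ` {..<n} = {..<n} \<and> blockwise n (2 * w) (f \<circ> narr s' ''u''))"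
    by (rule runs_conseq) (use w in auto)
  then show ?thesis
    unfolding merge_pass_def new_block_def using s w
    apply simp
    apply (intro conjI)
    apply (linarith+)[4]
    apply (erule runs_conseq)
    apply auto
    done
qed

definition sort_loop :: com where
  "sort_loop = While (NLess (NReg ''w'') (NReg ''n''))
     (merge_pass ;; NAssign ''w'' (NAdd (NReg ''w'') (NReg ''w'')))"

definition sort_coordinate :: com where
  "sort_coordinate =
     For ''i'' ''n'' (NPut ''u'' (NReg ''i'') (NReg ''i'')) ;;
     NAssign ''w'' (NConst 1) ;; sort_loop ;;
     For ''i'' ''n'' (NPut ''perm'' (NAdd (NReg ''b'') (NReg ''i'')) (NGet ''u'' (NReg ''i'')))"

lemma modifies_sort_loop [simp]:
  "nregs_of sort_loop = {''i'', ''mid'', ''j'', ''hi'', ''q'', ''w''}" "rregs_of sort_loop = {}"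
  "narrs_of sort_loop = {''v'', ''u''}" "rarrs_of sort_loop = {}"
  by (auto simp: sort_loop_def)

lemma modifies_sort_coordinate [simp]:
  "nregs_of sort_coordinate = {''i'', ''mid'', ''j'', ''hi'', ''q'', ''w''}"
  "rregs_of sort_coordinate = {}"
  "narrs_of sort_coordinate = {''v'', ''u'', ''perm''}" "rarrs_of sort_coordinate = {}"
  by (auto simp: sort_coordinate_def)

text \<open>The program computes no logarithm. The exponent \<open>r\<close> bounds the passes left:
  each pass doubles \<open>w\<close> and lowers \<open>r\<close> by one, which preserves
  \<open>w * 2 ^ r\<close>.\<close>

lemma runs_sort_loop:
  assumes "nreg s ''n'' = n" "nreg s ''w'' = w" "1 \<le> w" "1 \<le> n" "n \<le> w * 2 ^ r"
    and "narr s ''u'' ` {..<n} = {..<n}" "blockwise n w (f \<circ> narr s ''u'')"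
    and "\<And>i. i < n \<Longrightarrow> rarr s ''X'' (narr s ''row'' i + nreg s ''k'') = f i"
  shows "runs sort_loop s (r * (220 * n) + 5 * n) (\<lambda>s'. sorting n f (narr s' ''u''))"
  using assms
proof (induction r arbitrary: s w)
  case 0
  then have "sorting n f (narr s ''u'')"
    using sorting_iff_blockwise[of n w f "narr s ''u''"] by (simp add: comp_def)
  with 0 show ?case unfolding sort_loop_def by (intro runs_While_False) auto
next
  case (Suc r)
  show ?case
  proof (cases "w < n")
    case False
    then have "sorting n f (narr s ''u'')"
      using Suc.prems sorting_iff_blockwise[of n w f "narr s ''u''"] by (simp add: comp_def)
    with False Suc.prems show ?thesis unfolding sort_loop_def by (intro runs_While_False) auto
  next
    case True
    show ?thesis unfolding sort_loop_def
    proof (rule runs_While_True)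
      show "bval (NLess (NReg ''w'') (NReg ''n'')) s" using True Suc.prems by simp
      show "bcost (NLess (NReg ''w'') (NReg ''n'')) + (r * (220 * n) + 210 * n) + 1 \<le> Suc r * (220 * n) + 5 * n"
        using Suc.prems by simp
      show "runs ((merge_pass ;; NAssign ''w'' (NAdd (NReg ''w'') (NReg ''w''))) ;;
          While (NLess (NReg ''w'') (NReg ''n''))
            (merge_pass ;; NAssign ''w'' (NAdd (NReg ''w'') (NReg ''w''))))
          s (r * (220 * n) + 210 * n) (\<lambda>s'. sorting n f (narr s' ''u''))"
        unfolding sort_loop_def[symmetric] runs_Seq_assoc
      proof (rule runs_Seq[OF runs_merge_pass[where n = n and w = w and f = f],
            where U = "4 + (r * (220 * n) + 5 * n)"], goal_cases)
        case (8 s1)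
        note fr = frameD[OF 8(1)]
        let ?s = "s1\<lparr>nreg := (nreg s1)(''w'' := 2 * w)\<rparr>"
        have "runs sort_loop ?s (r * (220 * n) + 5 * n) (\<lambda>s'. sorting n f (narr s' ''u''))"
          by (rule Suc.IH[where w = "2 * w"]) (use 8 Suc.prems in \<open>auto simp: fr comp_def\<close>)
        then show ?case using Suc.prems by (simp add: fr mult_2)
      qed (use Suc.prems in \<open>auto simp: comp_def\<close>)
    qed
  qed
qed

lemma sorting_cong: "(\<And>h. h < n \<Longrightarrow> \<pi> h = \<rho> h) \<Longrightarrow> sorting n f \<pi> \<longleftrightarrow> sorting n f \<rho>"
  using image_cong[of "{..<n}" "{..<n}" \<pi> \<rho>] by (auto simp: sorting_def)

text \<open>The order is written from offset \<open>b\<close> upwards; the second conjunct preserves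
  the orders of earlier coordinates, stored below.\<close>

lemma runs_sort_coordinate:
  assumes n: "nreg s ''n'' = n" "1 \<le> n" "n \<le> 2 ^ r"
    and f: "\<And>i. i < n \<Longrightarrow> rarr s ''X'' (narr s ''row'' i + nreg s ''k'') = f i"
  shows "runs sort_coordinate s ((220 * r + 50) * n) (\<lambda>s'.
    sorting n f (\<lambda>h. narr s' ''perm'' (nreg s ''b'' + h)) \<and>
    (\<forall>g<nreg s ''b''. narr s' ''perm'' g = narr s ''perm'' g))"
proof -
  have init: "runs (For ''i'' ''n'' (NPut ''u'' (NReg ''i'') (NReg ''i''))) s (17 * n)
      (\<lambda>s'. \<forall>i<n. narr s' ''u'' i = i)"
    by (rule runs_For[where I = "\<lambda>k s'. \<forall>i<k. narr s' ''u'' i = i" and T = 3 and N = n])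
      (use n in \<open>auto simp: less_Suc_eq\<close>)
  have copy: "runs (For ''i'' ''n'' (NPut ''perm'' (NAdd (NReg ''b'') (NReg ''i'')) (NGet ''u'' (NReg ''i''))))
      s' (20 * n) (\<lambda>s''. (\<forall>i<n. narr s'' ''perm'' (nreg s' ''b'' + i) = narr s' ''u'' i) \<and>
        (\<forall>g<nreg s' ''b''. narr s'' ''perm'' g = narr s' ''perm'' g))"
    if "nreg s' ''n'' = n" for s'
    by (rule runs_For[where I = "\<lambda>k s''. (\<forall>i<k. narr s'' ''perm'' (nreg s' ''b'' + i) = narr s' ''u'' i) \<and>
        (\<forall>g<nreg s' ''b''. narr s'' ''perm'' g = narr s' ''perm'' g)" and T = 6 and N = n])
      (use that n in \<open>auto simp: frameD less_Suc_eq\<close>)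
  show ?thesis unfolding sort_coordinate_def
  proof (rule runs_Seq[OF init, where U = "2 + ((r * (220 * n) + 5 * n) + 20 * n)"], goal_cases)
    case (1 s1)
    note fr1 = frameD[OF 1(1)]
    let ?s2 = "s1\<lparr>nreg := (nreg s1)(''w'' := 1)\<rparr>"
    have im: "narr s1 ''u'' ` {..<n} = {..<n}" using 1(2) by (auto simp: image_iff)
    have sort: "runs sort_loop ?s2 (r * (220 * n) + 5 * n) (\<lambda>s'. sorting n f (narr s' ''u''))"
      by (rule runs_sort_loop[where w = 1]) (use 1 n f im blockwise_1 in \<open>auto simp: fr1\<close>)
    have "runs (sort_loop ;;
        For ''i'' ''n'' (NPut ''perm'' (NAdd (NReg ''b'') (NReg ''i'')) (NGet ''u'' (NReg ''i''))))
        ?s2 ((r * (220 * n) + 5 * n) + 20 * n)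
        (\<lambda>s'. sorting n f (\<lambda>h. narr s' ''perm'' (nreg s ''b'' + h)) \<and>
          (\<forall>g<nreg s ''b''. narr s' ''perm'' g = narr s ''perm'' g))"
    proof (rule runs_Seq[OF sort _ order_refl])
      fix s3 assume s3: "frame sort_loop ?s2 s3" "sorting n f (narr s3 ''u'')"
      note fr3 = frameD[OF s3(1)]
      have b: "nreg s3 ''n'' = n" "nreg s3 ''b'' = nreg s ''b''" "narr s3 ''perm'' = narr s ''perm''"
        using n by (simp_all add: fr3 fr1)
      show "runs (For ''i'' ''n'' (NPut ''perm'' (NAdd (NReg ''b'') (NReg ''i'')) (NGet ''u'' (NReg ''i''))))
        s3 (20 * n) (\<lambda>s'. sorting n f (\<lambda>h. narr s' ''perm'' (nreg s ''b'' + h)) \<and>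
          (\<forall>g<nreg s ''b''. narr s' ''perm'' g = narr s ''perm'' g))"
      proof (rule runs_conseq[OF copy[OF b(1)] order_refl])
        fix s4 assume s4: "(\<forall>i<n. narr s4 ''perm'' (nreg s3 ''b'' + i) = narr s3 ''u'' i) \<and>
          (\<forall>g<nreg s3 ''b''. narr s4 ''perm'' g = narr s3 ''perm'' g)"
        then have "sorting n f (\<lambda>h. narr s4 ''perm'' (nreg s3 ''b'' + h))"
          using s3(2) sorting_cong[of n "\<lambda>h. narr s4 ''perm'' (nreg s3 ''b'' + h)" "narr s3 ''u''" f] by simp
        then show "sorting n f (\<lambda>h. narr s4 ''perm'' (nreg s ''b'' + h)) \<and>
          (\<forall>g<nreg s ''b''. narr s4 ''perm'' g = narr s ''perm'' g)"
          using s4 b by simp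
      qed
    qed
    then show ?case by simp
  next
    case 2
    then show ?case using n by (simp add: algebra_simps)
  qed
qed

section \<open>Preprocessing all coordinates\<close>

definition precompute :: com where
  "precompute = rows ;; NAssign ''b'' (NConst 0) ;;
     For ''k'' ''d'' (sort_coordinate ;; NAssign ''b'' (NAdd (NReg ''b'') (NReg ''n'')))"

lemma modifies_precompute [simp]:
  "nregs_of precompute = {''q'', ''i'', ''b'', ''k'', ''mid'', ''j'', ''hi'', ''w''}"
  "rregs_of precompute = {}"
  "narrs_of precompute = {''row'', ''v'', ''u'', ''perm''}" "rarrs_of precompute = {}"
  by (auto simp: precompute_def)

lemma runs_precompute:
  assumes pos: "1 \<le> n" "1 \<le> d" and l: "loaded n d p x s" and r: "n \<le> 2 ^ r"
  shows "runs precompute s ((220 * r + 110) * (n * d)) (\<lambda>s'. loaded n d p x s' \<and> ordered n d x s')"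
proof -
  have s: "nreg s ''n'' = n" "nreg s ''d'' = d"
    and X: "\<And>i k. i < n \<Longrightarrow> k < d \<Longrightarrow> rarr s ''X'' (i * d + k) = x i $ k"
    using l by (auto simp: loaded_def)
  let ?I = "\<lambda>k s'. nreg s' ''b'' = k * n \<and>
    (\<forall>k'<k. sorting n (\<lambda>i. x i $ k') (\<lambda>h. narr s' ''perm'' (k' * n + h)))"
  have "runs precompute s ((220 * r + 110) * (n * d)) (ordered n d x)"
    unfolding precompute_def
  proof (rule runs_Seq[OF runs_rows[where n = n], where U = "2 + d * ((220 * r + 54) * n + 14)"], goal_cases)
    case (3 s1)
    then have s1: "nreg s1 ''n'' = n" "nreg s1 ''d'' = d" "rarr s1 ''X'' = rarr s ''X''"
      "\<And>i. i < n \<Longrightarrow> narr s1 ''row'' i = i * d"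
      using s by (simp_all add: frameD)
    let ?s2 = "s1\<lparr>nreg := (nreg s1)(''b'' := 0)\<rparr>"
    have "runs (For ''k'' ''d'' (sort_coordinate ;; NAssign ''b'' (NAdd (NReg ''b'') (NReg ''n''))))
        ?s2 (d * ((220 * r + 54) * n + 14)) (ordered n d x)"
    proof (rule runs_For[where I = ?I and T = "(220 * r + 54) * n" and N = d], goal_cases)
      case (7 k s3)
      note fr = frameD[OF 7(2)]
      let ?f = "\<lambda>i. x i $ k"
      show ?case
      proof (rule runs_Seq[OF runs_sort_coordinate[where n = n and f = ?f and r = r], where U = "4 * n"], goal_cases)
        case (5 s4)
        note fr4 = frameD[OF 5(1)]
        have "sorting n (\<lambda>i. x i $ k') (\<lambda>h. narr s4 ''perm'' (k' * n + h))" if "k' < Suc k" for k'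
        proof (cases "k' = k")
          case True
          then show ?thesis using 5 7 by simp
        next
          case False
          then have "k' < k" using that by simp
          \<comment> \<open>The segment of \<open>k'\<close> ends no later than the offset
            \<open>k * n\<close> from which the new order is written.\<close>
          then have "Suc k' * n \<le> k * n" by (intro mult_le_mono1) simp
          then have "narr s4 ''perm'' (k' * n + h) = narr s3 ''perm'' (k' * n + h)" if "h < n" for h
            using 5 7(4) that by simp
          then have "sorting n (\<lambda>i. x i $ k') (\<lambda>h. narr s4 ''perm'' (k' * n + h)) \<longleftrightarrow>
              sorting n (\<lambda>i. x i $ k') (\<lambda>h. narr s3 ''perm'' (k' * n + h))"
            by (rule sorting_cong)
          then show ?thesis using 7(4) \<open>k' < k\<close> by blast
        qed
        then show ?case using pos 7 s1 by (simp add: fr4 fr)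
      qed (use s1 7 X pos r in \<open>auto simp: fr add_mult_distrib\<close>)
    qed (use s1 pos in \<open>auto simp: ordered_def\<close>)
    then show ?case by simp
  next
    case 4
    have "n \<le> n * d" "d \<le> n * d" "1 \<le> n * d" using pos by auto
    moreover have "d * ((220 * r + 54) * n + 14) = 220 * r * (n * d) + 54 * (n * d) + 14 * d"
      "(220 * r + 110) * (n * d) = 220 * r * (n * d) + 110 * (n * d)"
      by (simp_all add: algebra_simps)
    ultimately show ?case by linarith
  qed (use s pos in auto)
  then show ?thesis
    by (rule runs_conseq) (use l in \<open>auto simp: loaded_def frameD\<close>)
qed

section \<open>From the programs to products with the distance matrix\<close>

lemma loaded_input: "loaded n d p x (input n d p x)"
proof -
  have "i * d + k < n * d" if "i < n" "k < d" for i k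
  proof -
    have "Suc i * d \<le> n * d" using that by (intro mult_le_mono1) simp
    then show ?thesis using that by simp
  qed
  then show ?thesis by (auto simp: loaded_def input_def)
qed

text \<open>\<open>pnorm_pow\<close> is a sum over coordinates, so exchanging sums splits the
  product into \<open>d\<close> one-dimensional problems.\<close>

lemma dist_mat_mult_vec:
  assumes x: "\<And>i. i < n \<Longrightarrow> x i \<in> carrier_vec d" and z: "z \<in> carrier_vec n" and i: "i < n"
  shows "(dist_mat p n x *\<^sub>v z) $ i =
    (\<Sum>k<d. abs_power_sum p n (\<lambda>j. z $ j) (\<lambda>i. x i $ k) i)"
proof -
  have "(dist_mat p n x *\<^sub>v z) $ i = (\<Sum>j<n. pnorm_pow p (x i - x j) * z $ j)"
    using z i by (auto simp: dist_mat_def scalar_prod_def atLeast0LessThan)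
  also have "\<dots> = (\<Sum>j<n. \<Sum>k<d. z $ j * \<bar>x i $ k - x j $ k\<bar> ^ p)"
  proof (intro sum.cong refl)
    fix j assume "j \<in> {..<n}"
    then have "x j \<in> carrier_vec d" using x by simp
    then show "pnorm_pow p (x i - x j) * z $ j = (\<Sum>k<d. z $ j * \<bar>x i $ k - x j $ k\<bar> ^ p)"
      by (simp add: pnorm_pow_def sum_distrib_left mult.commute)
  qed
  also have "\<dots> = (\<Sum>k<d. \<Sum>j<n. z $ j * \<bar>x i $ k - x j $ k\<bar> ^ p)" by (rule sum.swap)
  finally show ?thesis by (simp add: abs_power_sum_def)
qed

text \<open>Induction over the queries for arbitrary memory: posing a query writes only
  \<open>z\<close>, and by its frame \<open>query\<close> leaves the points, the sorted orders and
  the input sizes intact.\<close>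

lemma answers_query:
  assumes pos: "1 \<le> n" "1 \<le> d" "1 \<le> p" and x: "\<And>i. i < n \<Longrightarrow> x i \<in> carrier_vec d"
    and "loaded n d p x s" "odd p \<Longrightarrow> ordered n d x s" and "set zs \<subseteq> carrier_vec n"
  shows "answers query (dist_mat p n x) (700 * (real n * real d * real p)) s zs"
  using assms(5-)
proof (induction zs arbitrary: s)
  case Nil
  then show ?case by simp
next
  case (Cons z zs)
  have z: "z \<in> carrier_vec n" using Cons.prems by simp
  let ?s = "pose_query z s"
  have q: "loaded n d p x ?s" "odd p \<Longrightarrow> ordered n d x ?s"
    using Cons.prems by (auto simp: loaded_def ordered_def pose_query_def)
  obtain t s' where e: "exec query ?s t s'" and t: "t \<le> 700 * (n * d * p)"
    and y: "\<And>i. i < n \<Longrightarrow> rarr s' ''y'' i =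
      (\<Sum>k<d. abs_power_sum p n (rarr ?s ''z'') (\<lambda>i. x i $ k) i)"
    using runs_query[OF pos q] unfolding runs_def by blast
  have fr: "frame query ?s s'" using e by (rule exec_frame)
  have "loaded n d p x s'" "odd p \<Longrightarrow> ordered n d x s'"
    using q by (auto simp: loaded_def ordered_def frameD[OF fr])
  then have "answers query (dist_mat p n x) (700 * (real n * real d * real p)) s' zs"
    using Cons by simp
  moreover have "result n s' = dist_mat p n x *\<^sub>v z"
  proof (rule eq_vecI)
    fix i assume "i < dim_vec (dist_mat p n x *\<^sub>v z)"
    then have i: "i < n" by (simp add: dist_mat_def)
    have "rarr ?s ''z'' j = z $ j" if "j < n" for j
      using that z by (simp add: pose_query_def)
    then show "result n s' $ i = (dist_mat p n x *\<^sub>v z) $ i"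
      using i by (simp add: result_def y dist_mat_mult_vec[OF x z i] abs_power_sum_def)
  qed (simp add: result_def dist_mat_def)
  moreover have "real t \<le> real (700 * (n * d * p))" using t by (rule of_nat_mono)
  moreover have "dim_row (dist_mat p n x) = n" by (simp add: dist_mat_def)
  ultimately show ?case using e by auto
qed

lemma power_of_two_above:
  assumes "1 \<le> n"
  obtains r where "n \<le> 2 ^ r" "real r \<le> log 2 (real n) + 1"
proof
  let ?r = "nat \<lceil>log 2 (real n)\<rceil>"
  have nonneg: "0 \<le> log 2 (real n)" using assms by simp
  then show "real ?r \<le> log 2 (real n) + 1" by linarith
  have "real n = 2 powr log 2 (real n)" using assms by simp
  also have "\<dots> \<le> 2 powr real ?r" using nonneg by (intro powr_mono) linarith+
  also have "\<dots> = real (2 ^ ?r)" by (simp add: powr_realpow)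
  finally show "n \<le> 2 ^ ?r" by (simp only: of_nat_le_iff)
qed

text \<open>One pair of programs and one constant serve all sizes. The \<open>max 1\<close> covers
  \<open>n = 1\<close>, where the logarithm vanishes but preprocessing still takes time.\<close>

theorem theorem1:
  "\<exists>(Pre :: com) (Query :: com) (C :: real).
     \<forall>(n :: nat) (d :: nat) (p :: nat) (x :: nat \<Rightarrow> real vec).
       n \<ge> 1 \<longrightarrow> d \<ge> 1 \<longrightarrow> p \<ge> 1 \<longrightarrow> (\<forall>i<n. x i \<in> carrier_vec d) \<longrightarrow>
       (even p \<longrightarrow>
          (\<forall>zs. set zs \<subseteq> carrier_vec n \<longrightarrow>
             answers Query (dist_mat p n x) (C * (real n * real d * real p)) (input n d p x) zs)) \<and>
       (odd p \<longrightarrow>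
          (\<exists>t s. exec Pre (input n d p x) t s \<and>
             real t \<le> C * (real n * real d * max 1 (log 2 (real n))) \<and>
             (\<forall>zs. set zs \<subseteq> carrier_vec n \<longrightarrow>
                answers Query (dist_mat p n x) (C * (real n * real d * real p)) s zs)))"
proof (rule exI[of _ precompute], rule exI[of _ query], rule exI[of _ 700], intro allI impI conjI)
  fix n d p :: nat and x :: "nat \<Rightarrow> real vec"
  assume pos: "1 \<le> n" "1 \<le> d" "1 \<le> p" and x: "\<forall>i<n. x i \<in> carrier_vec d"
  note answers = answers_query[where x = x, OF pos]
  show "answers query (dist_mat p n x) (700 * (real n * real d * real p)) (input n d p x) zs"
    if "even p" "set zs \<subseteq> carrier_vec n" for zs
    using that loaded_input x by (intro answers) auto
  show "\<exists>t s. exec precompute (input n d p x) t s \<and>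
      real t \<le> 700 * (real n * real d * max 1 (log 2 (real n))) \<and>
      (\<forall>zs. set zs \<subseteq> carrier_vec n \<longrightarrow>
         answers query (dist_mat p n x) (700 * (real n * real d * real p)) s zs)"
  proof -
    obtain r where r: "n \<le> 2 ^ r" "real r \<le> log 2 (real n) + 1"
      by (rule power_of_two_above[OF pos(1)])
    obtain t s where e: "exec precompute (input n d p x) t s"
      and t: "t \<le> (220 * r + 110) * (n * d)" and s: "loaded n d p x s" "ordered n d x s"
      using runs_precompute[OF pos(1,2) loaded_input r(1)] unfolding runs_def by blast
    have "real t \<le> real ((220 * r + 110) * (n * d))" using t by (rule of_nat_mono)
    also have "\<dots> = (220 * real r + 110) * (real n * real d)" by simp
    \<comment> \<open>\<open>r\<close> exceeds the logarithm by at most 1, so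
      \<open>220 * r + 110\<close> is at most 550 times the maximum.\<close>
    also have "\<dots> \<le> (700 * max 1 (log 2 (real n))) * (real n * real d)"
      using r(2) by (intro mult_right_mono) auto
    finally have "real t \<le> 700 * (real n * real d * max 1 (log 2 (real n)))"
      by (simp add: mult_ac)
    then show ?thesis using e s x answers by blast
  qed
qed

end
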